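(* Let $(M,g_R)$ be a closed almost Kähler manifold, with compatible almost complex structure $J_R$, and consider on $\mathbb{S}^1\times\mathbb{S}^1\times M$ the Lorentzian metric $$h=2\,d\varphi\,d\theta+H\,d\theta^2+g_R ,$$ where $H$ is any smooth function on $\mathbb{S}^1\times M$, i.e. one that is independent of the first angular coordinate $\varphi$. With respect to the vector field $$T=\tfrac12(H+1)\partial_\varphi-\partial_\theta ,$$ let $g$ denote the Riemannian metric dual to $h$: $$g=h+2T^\flat\otimes T^\flat,\qquad T^\flat=h(T,\cdot).$$ Then $g$ (with the almost complex structure $J$ described in the context) is an almost Kähler metric on $\mathbb{S}^1\times\mathbb{S}^1\times M$, which is not a warped product, and which is Kähler if and only if $H$ is constant on $M$ and $(M,g_R)$ is Kähler. Furthermore, the fundamental 2-form $\omega=g(\cdot,J\cdot)$ of $g$ is also co-closed with respect to the Lorentzian metric $h$.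
   Context: $\varphi,\theta$ are the standard angular coordinates on $\mathbb{S}^1\times\mathbb{S}^1$; $d\varphi\,d\theta$ is the symmetric product, so $h(\partial_\varphi,\partial_\theta)=1$, $h(\partial_\theta,\partial_\theta)=H$, $h(\partial_\varphi,\partial_\varphi)=0$. One has $h(T,T)=-1$. "Closed" manifold means compact without boundary. "$H$ is constant on $M$" means that $X(H)=0$ for every vector $X$ tangent to $M$. The almost complex structure $J$ on $\mathbb{S}^1\times\mathbb{S}^1\times M$ is the one that equals $J_R$ on vectors tangent to $M$ and satisfies $JT=Z$, $JZ=-T$, where $Z=\tfrac12(H-1)\partial_\varphi-\partial_\theta$. An almost complex structure $J$ is a smooth endomorphism of the tangent bundle with $J^2=-1$; it is compatible with a Riemannian metric $g$ if $g(J\cdot,J\cdot)=g$, and then $\omega=g(\cdot,J\cdot)$ is the fundamental 2-form. An even-dimensional Riemannian manifold is almost Kähler if it has a compatible $J$ for which $\omega$ is closed, and Kähler if in addition $J$ is integrable, i.e. the Nijenhuis tensor $N_J(a,b)=[Ja,Jb]-J[Ja,b]-J[a,Jb]-[a,b]$ vanishes identically. A warped product is a Riemannian metric on a product $B\times F$ of the form $g_B+f^2g_F$, with $g_B,g_F$ metrics on $B,F$ and $f>0$ a smooth function on $B$. A 2-form $\omega$ is co-closed with respect to a (pseudo-Riemannian) metric $h$ if its codifferential with respect to $h$ vanishes, i.e. $d( *_h\omega)=0$, where $*_h$ is the Hodge star of $h$.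
   Formalization: If H is constant on M, g is a direct product, i.e. a warped product with f=1. So "not a warped product" is proved for non-constant f for every H, and for any f when H is not constant on M, with base and fibre formed from the factors S^1, S^1, M. *)

theory Defs
  imports "HOL-Analysis.Analysis" "Jordan_Normal_Form.Determinant"
begin

section \<open>Smooth maps and smooth manifolds\<close>

primrec Ck_on :: "nat \<Rightarrow> 'a::real_normed_vector set \<Rightarrow> ('a \<Rightarrow> 'b::real_normed_vector) \<Rightarrow> bool" where
  "Ck_on 0 S f \<longleftrightarrow> continuous_on S f"
| "Ck_on (Suc k) S f \<longleftrightarrow>
     f differentiable_on S \<and> (\<forall>v. Ck_on k S (\<lambda>x. frechet_derivative f (at x) v))"

text \<open>Only used for open \<open>S\<close>.\<close>

definition smooth_on :: "'a::real_normed_vector set \<Rightarrow> ('a \<Rightarrow> 'b::real_normed_vector) \<Rightarrow> bool" where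
  "smooth_on S f \<longleftrightarrow> (\<forall>k. Ck_on k S f)"

text \<open>A manifold is a topological space with an indexed (not necessarily maximal) atlas.
  Chart \<open>i\<close> is the map \<open>crd M i\<close>, restricted to \<open>cdom M i\<close>, into the Euclidean model space \<open>'e\<close>.
  The model space has positive dimension.\<close>

record ('a, 'i, 'e) manifold =
  mtop :: "'a topology"
  ind :: "'i set"
  cdom :: "'i \<Rightarrow> 'a set"
  crd :: "'i \<Rightarrow> 'a \<Rightarrow> 'e"

definition param :: "('a, 'i, 'e) manifold \<Rightarrow> 'i \<Rightarrow> 'e \<Rightarrow> 'a" where
  "param M i = inv_into (cdom M i) (crd M i)"

definition smooth_manifold :: "('a, 'i, 'e::euclidean_space) manifold \<Rightarrow> bool" where
  "smooth_manifold M \<longleftrightarrow>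
     Hausdorff_space (mtop M) \<and> second_countable (mtop M) \<and> topspace (mtop M) \<noteq> {} \<and>
     topspace (mtop M) = (\<Union>i\<in>ind M. cdom M i) \<and>
     (\<forall>i\<in>ind M. openin (mtop M) (cdom M i) \<and> open (crd M i ` cdom M i) \<and>
        homeomorphic_map (subtopology (mtop M) (cdom M i)) (top_of_set (crd M i ` cdom M i)) (crd M i)) \<and>
     (\<forall>i\<in>ind M. \<forall>j\<in>ind M.
        smooth_on (crd M i ` (cdom M i \<inter> cdom M j)) (crd M j \<circ> param M i))"

definition closed_manifold :: "('a, 'i, 'e::euclidean_space) manifold \<Rightarrow> bool" where
  "closed_manifold M \<longleftrightarrow> smooth_manifold M \<and> compact_space (mtop M)"

definition prod_manifold ::
    "('a, 'i, 'e) manifold \<Rightarrow> ('b, 'j, 'f) manifold \<Rightarrow> ('a \<times> 'b, 'i \<times> 'j, 'e \<times> 'f) manifold"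
    (infixr "\<times>\<^sub>M" 75) where
  "M \<times>\<^sub>M N =
     \<lparr> mtop = prod_topology (mtop M) (mtop N),
       ind = ind M \<times> ind N,
       cdom = (\<lambda>(i, j). cdom M i \<times> cdom N j),
       crd = (\<lambda>(i, j). map_prod (crd M i) (crd N j)) \<rparr>"

text \<open>The unit circle with all angular charts with values in an interval \<open>(a, a + 2\<pi>)\<close>.\<close>

definition circle :: "(complex, real, real) manifold" where
  "circle =
     \<lparr> mtop = top_of_set (sphere 0 1),
       ind = UNIV,
       cdom = (\<lambda>a. cis ` {a<..<a + 2 * pi}),
       crd = (\<lambda>a. inv_into {a<..<a + 2 * pi} cis) \<rparr>"

text \<open>Derivative at the point \<open>p\<close>, in chart \<open>i\<close>, in the direction with components \<open>v\<close>.\<close>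

definition cderiv ::
    "('a, 'i, 'e::euclidean_space) manifold \<Rightarrow> 'i \<Rightarrow> ('a \<Rightarrow> 'b::real_normed_vector) \<Rightarrow> 'a \<Rightarrow> 'e \<Rightarrow> 'b" where
  "cderiv M i f p v = frechet_derivative (f \<circ> param M i) (at (crd M i p)) v"

definition smooth_in_chart ::
    "('a, 'i, 'e::euclidean_space) manifold \<Rightarrow> 'i \<Rightarrow> ('a \<Rightarrow> 'b::real_normed_vector) \<Rightarrow> bool" where
  "smooth_in_chart M i f \<longleftrightarrow> smooth_on (crd M i ` cdom M i) (f \<circ> param M i)"

definition smooth_function :: "('a, 'i, 'e::euclidean_space) manifold \<Rightarrow> ('a \<Rightarrow> real) \<Rightarrow> bool" where
  "smooth_function M f \<longleftrightarrow> (\<forall>i\<in>ind M. smooth_in_chart M i f)"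

section \<open>Tensor fields\<close>

text \<open>A tensor field is given by its components in all charts: the first argument is the index of
  a chart, the second a point of its domain, and the remaining ones are tangent vectors at that
  point, given by their components in that chart. The components of a tangent vector change from
  chart \<open>i\<close> to chart \<open>j\<close> by \<open>cderiv M i (crd M j) p\<close>, the derivative of the transition map.\<close>

type_synonym ('a, 'i, 'e) tensor2 = "'i \<Rightarrow> 'a \<Rightarrow> 'e \<Rightarrow> 'e \<Rightarrow> real"
type_synonym ('a, 'i, 'e) endo = "'i \<Rightarrow> 'a \<Rightarrow> 'e \<Rightarrow> 'e"
type_synonym ('a, 'i, 'e) vfield = "'i \<Rightarrow> 'a \<Rightarrow> 'e"
type_synonym ('a, 'i, 'e) form = "'i \<Rightarrow> 'a \<Rightarrow> 'e list \<Rightarrow> real"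

definition riemannian_metric ::
    "('a, 'i, 'e::euclidean_space) manifold \<Rightarrow> ('a, 'i, 'e) tensor2 \<Rightarrow> bool" where
  "riemannian_metric M g \<longleftrightarrow>
     (\<forall>i\<in>ind M. \<forall>p\<in>cdom M i.
        bilinear (g i p) \<and> (\<forall>u v. g i p u v = g i p v u) \<and> (\<forall>u. u \<noteq> 0 \<longrightarrow> g i p u u > 0)) \<and>
     (\<forall>i\<in>ind M. \<forall>u v. smooth_in_chart M i (\<lambda>p. g i p u v)) \<and>
     (\<forall>i\<in>ind M. \<forall>j\<in>ind M. \<forall>p\<in>cdom M i \<inter> cdom M j. \<forall>u v.
        g j p (cderiv M i (crd M j) p u) (cderiv M i (crd M j) p v) = g i p u v)"

definition almost_complex ::
    "('a, 'i, 'e::euclidean_space) manifold \<Rightarrow> ('a, 'i, 'e) endo \<Rightarrow> bool" where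
  "almost_complex M J \<longleftrightarrow>
     (\<forall>i\<in>ind M. \<forall>p\<in>cdom M i. linear (J i p) \<and> (\<forall>u. J i p (J i p u) = - u)) \<and>
     (\<forall>i\<in>ind M. \<forall>u. smooth_in_chart M i (\<lambda>p. J i p u)) \<and>
     (\<forall>i\<in>ind M. \<forall>j\<in>ind M. \<forall>p\<in>cdom M i \<inter> cdom M j. \<forall>u.
        J j p (cderiv M i (crd M j) p u) = cderiv M i (crd M j) p (J i p u))"

definition compatible ::
    "('a, 'i, 'e) manifold \<Rightarrow> ('a, 'i, 'e) tensor2 \<Rightarrow> ('a, 'i, 'e) endo \<Rightarrow> bool" where
  "compatible M g J \<longleftrightarrow>
     (\<forall>i\<in>ind M. \<forall>p\<in>cdom M i. \<forall>u v. g i p (J i p u) (J i p v) = g i p u v)"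

section \<open>Differential forms\<close>

text \<open>A \<open>k\<close>-form takes lists of \<open>k\<close> tangent vectors.\<close>

definition fundamental_form ::
    "('a, 'i, 'e) tensor2 \<Rightarrow> ('a, 'i, 'e) endo \<Rightarrow> ('a, 'i, 'e) form" where
  "fundamental_form g J = (\<lambda>i p vs. g i p (vs ! 0) (J i p (vs ! 1)))"

text \<open>The exterior derivative in a chart, evaluated on (commuting) constant coordinate vector fields:
  \<open>d\<alpha>(v\<^sub>0, \<dots>, v\<^sub>k) = \<Sum>\<^sub>j (-1)\<^sup>j v\<^sub>j(\<alpha>(v\<^sub>0, \<dots>, v\<^sub>j omitted, \<dots>, v\<^sub>k))\<close>.\<close>

definition ext_deriv ::
    "('a, 'i, 'e::euclidean_space) manifold \<Rightarrow> ('a, 'i, 'e) form \<Rightarrow> ('a, 'i, 'e) form" where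
  "ext_deriv M \<alpha> = (\<lambda>i p vs.
     \<Sum>j<length vs. (-1) ^ j *
       cderiv M i (\<lambda>q. \<alpha> i q (take j vs @ drop (Suc j) vs)) p (vs ! j))"

definition closed_form ::
    "('a, 'i, 'e::euclidean_space) manifold \<Rightarrow> nat \<Rightarrow> ('a, 'i, 'e) form \<Rightarrow> bool" where
  "closed_form M k \<alpha> \<longleftrightarrow>
     (\<forall>i\<in>ind M. \<forall>p\<in>cdom M i. \<forall>vs. length vs = Suc k \<longrightarrow> ext_deriv M \<alpha> i p vs = 0)"

text \<open>For a nondegenerate symmetric bilinear form \<open>b\<close>, \<open>dual_vec b e\<close> for \<open>e \<in> Basis\<close> is the
  \<open>b\<close>-dual basis vector of \<open>e\<close>, i.e. \<open>e\<^sub>i\<close> is mapped to \<open>\<Sum>\<^sub>j b\<^sup>i\<^sup>j e\<^sub>j\<close>.\<close>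

definition dual_vec :: "('e \<Rightarrow> 'e \<Rightarrow> real) \<Rightarrow> 'e \<Rightarrow> 'e::euclidean_space" where
  "dual_vec b e = (THE w. \<forall>c\<in>Basis. b w c = (if c = e then 1 else 0))"

text \<open>The volume form \<open>\<surd>\<bar>det (b\<^sub>i\<^sub>j)\<bar> dx\<^sub>1 \<and> \<dots> \<and> dx\<^sub>n\<close> of \<open>b\<close>,
  where \<open>bs\<close> is an enumeration of \<open>Basis\<close>.\<close>

definition vol_form :: "'e list \<Rightarrow> ('e \<Rightarrow> 'e \<Rightarrow> real) \<Rightarrow> 'e::euclidean_space list \<Rightarrow> real" where
  "vol_form bs b vs =
     sqrt \<bar>Determinant.det (Matrix.mat DIM('e) DIM('e) (\<lambda>(i, j). b (bs ! i) (bs ! j)))\<bar> *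
     Determinant.det (Matrix.mat DIM('e) DIM('e) (\<lambda>(i, j). inner (vs ! i) (bs ! j)))"

text \<open>The Hodge star \<open>(*\<beta>)(w\<^sub>1, \<dots>) = 1/k! \<beta>\<^sup>i\<^sup>1\<^sup>.\<^sup>.\<^sup>.\<^sup>i\<^sup>k vol(e\<^sub>i\<^sub>1, \<dots>, e\<^sub>i\<^sub>k, w\<^sub>1, \<dots>)\<close> on \<open>k\<close>-forms, in charts
  oriented by the enumeration \<open>bs\<close> of \<open>Basis\<close>.\<close>

definition hodge_star ::
    "'e list \<Rightarrow> ('a, 'i, 'e) tensor2 \<Rightarrow> nat \<Rightarrow> ('a, 'i, 'e::euclidean_space) form \<Rightarrow> ('a, 'i, 'e) form" where
  "hodge_star bs h k \<beta> = (\<lambda>i p ws.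
     (\<Sum>as\<in>{as. set as \<subseteq> Basis \<and> length as = k}.
        \<beta> i p (map (dual_vec (h i p)) as) * vol_form bs (h i p) (as @ ws)) / fact k)"

text \<open>Reversing the orientation of a chart only changes the sign of the Hodge star, so that
  \<open>d(*\<beta>) = 0\<close> is a local condition that needs no global orientation.\<close>

definition coclosed ::
    "('a, 'i, 'e::euclidean_space) manifold \<Rightarrow> ('a, 'i, 'e) tensor2 \<Rightarrow> nat \<Rightarrow> ('a, 'i, 'e) form \<Rightarrow> bool" where
  "coclosed M h k \<beta> \<longleftrightarrow>
     (\<forall>bs. distinct bs \<and> set bs = Basis \<longrightarrow> closed_form M (DIM('e) - k) (hodge_star bs h k \<beta>))"

section \<open>Almost Kaehler and Kaehler metrics\<close>

definition almost_kaehler ::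
    "('a, 'i, 'e::euclidean_space) manifold \<Rightarrow> ('a, 'i, 'e) tensor2 \<Rightarrow> ('a, 'i, 'e) endo \<Rightarrow> bool" where
  "almost_kaehler M g J \<longleftrightarrow>
     even DIM('e) \<and> riemannian_metric M g \<and> almost_complex M J \<and> compatible M g J \<and>
     closed_form M 2 (fundamental_form g J)"

text \<open>Vector fields on the domain of chart \<open>i\<close>, given by their components in this chart, and their
  Lie bracket.\<close>

definition lie_bracket ::
    "('a, 'i, 'e::euclidean_space) manifold \<Rightarrow> 'i \<Rightarrow> ('a \<Rightarrow> 'e) \<Rightarrow> ('a \<Rightarrow> 'e) \<Rightarrow> 'a \<Rightarrow> 'e" where
  "lie_bracket M i a b p = cderiv M i b p (a p) - cderiv M i a p (b p)"

definition nijenhuis ::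
    "('a, 'i, 'e::euclidean_space) manifold \<Rightarrow> ('a, 'i, 'e) endo \<Rightarrow> 'i \<Rightarrow>
     ('a \<Rightarrow> 'e) \<Rightarrow> ('a \<Rightarrow> 'e) \<Rightarrow> 'a \<Rightarrow> 'e" where
  "nijenhuis M J i a b p =
     (let Ja = (\<lambda>q. J i q (a q)); Jb = (\<lambda>q. J i q (b q)) in
      lie_bracket M i Ja Jb p - J i p (lie_bracket M i Ja b p)
        - J i p (lie_bracket M i a Jb p) - lie_bracket M i a b p)"

definition integrable_acs ::
    "('a, 'i, 'e::euclidean_space) manifold \<Rightarrow> ('a, 'i, 'e) endo \<Rightarrow> bool" where
  "integrable_acs M J \<longleftrightarrow>
     (\<forall>i\<in>ind M. \<forall>a b. smooth_in_chart M i a \<and> smooth_in_chart M i b \<longrightarrow>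
        (\<forall>p\<in>cdom M i. nijenhuis M J i a b p = 0))"

definition kaehler ::
    "('a, 'i, 'e::euclidean_space) manifold \<Rightarrow> ('a, 'i, 'e) tensor2 \<Rightarrow> ('a, 'i, 'e) endo \<Rightarrow> bool" where
  "kaehler M g J \<longleftrightarrow> almost_kaehler M g J \<and> integrable_acs M J"

section \<open>Warped products\<close>

definition warped_with ::
    "('b, 'i, 'e::euclidean_space) manifold \<Rightarrow> ('f, 'j, 'k::euclidean_space) manifold \<Rightarrow>
     ('b \<Rightarrow> real) \<Rightarrow> ('b \<times> 'f, 'i \<times> 'j, 'e \<times> 'k) tensor2 \<Rightarrow> bool" where
  "warped_with B F f g \<longleftrightarrow>
     smooth_function B f \<and> (\<forall>p\<in>topspace (mtop B). f p > 0) \<and>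
     (\<exists>gB gF. riemannian_metric B gB \<and> riemannian_metric F gF \<and>
        (\<forall>i\<in>ind B. \<forall>j\<in>ind F. \<forall>p\<in>cdom B i. \<forall>q\<in>cdom F j. \<forall>u u' v v'.
           g (i, j) (p, q) (u, v) (u', v') = gB i p u u' + (f p)\<^sup>2 * gF j q v v'))"

definition warped_product ::
    "('b, 'i, 'e::euclidean_space) manifold \<Rightarrow> ('f, 'j, 'k::euclidean_space) manifold \<Rightarrow>
     ('b \<times> 'f, 'i \<times> 'j, 'e \<times> 'k) tensor2 \<Rightarrow> bool" where
  "warped_product B F g \<longleftrightarrow> (\<exists>f. warped_with B F f g)"

text \<open>Excludes the direct products, i.e. the constant warping functions.\<close>

definition proper_warped_product ::
    "('b, 'i, 'e::euclidean_space) manifold \<Rightarrow> ('f, 'j, 'k::euclidean_space) manifold \<Rightarrow>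
     ('b \<times> 'f, 'i \<times> 'j, 'e \<times> 'k) tensor2 \<Rightarrow> bool" where
  "proper_warped_product B F g \<longleftrightarrow>
     (\<exists>f. warped_with B F f g \<and> \<not> (\<exists>c. \<forall>p\<in>topspace (mtop B). f p = c))"

text \<open>The ways to regroup three factors into base and fibre. Each regrouping acts in the same way on
  chart indices, points and tangent vectors.\<close>

definition regroup2 :: "('b \<times> 'c) \<times> 'a \<Rightarrow> 'a \<times> 'b \<times> 'c" where "regroup2 = (\<lambda>((b, c), a). (a, b, c))"
definition regroup3 :: "'b \<times> 'a \<times> 'c \<Rightarrow> 'a \<times> 'b \<times> 'c" where "regroup3 = (\<lambda>(b, a, c). (a, b, c))"
definition regroup4 :: "('a \<times> 'c) \<times> 'b \<Rightarrow> 'a \<times> 'b \<times> 'c" where "regroup4 = (\<lambda>((a, c), b). (a, b, c))"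
definition regroup5 :: "('a \<times> 'b) \<times> 'c \<Rightarrow> 'a \<times> 'b \<times> 'c" where "regroup5 = (\<lambda>((a, b), c). (a, b, c))"
definition regroup6 :: "'c \<times> 'a \<times> 'b \<Rightarrow> 'a \<times> 'b \<times> 'c" where "regroup6 = (\<lambda>(c, a, b). (a, b, c))"

definition pull_tensor ::
    "('j \<Rightarrow> 'i) \<Rightarrow> ('b \<Rightarrow> 'a) \<Rightarrow> ('f \<Rightarrow> 'e) \<Rightarrow> ('a, 'i, 'e) tensor2 \<Rightarrow> ('b, 'j, 'f) tensor2" where
  "pull_tensor ri rp rv g = (\<lambda>j q u v. g (ri j) (rp q) (rv u) (rv v))"

text \<open>For a metric on \<open>X \<times> Y \<times> Z\<close>: it is a warped product for some distribution of the three
  factors over base and fibre.\<close>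

definition warped_product3 ::
    "('a, 'i, 'e::euclidean_space) manifold \<Rightarrow> ('b, 'j, 'f::euclidean_space) manifold \<Rightarrow>
     ('c, 'k, 'g::euclidean_space) manifold \<Rightarrow>
     ('a \<times> 'b \<times> 'c, 'i \<times> 'j \<times> 'k, 'e \<times> 'f \<times> 'g) tensor2 \<Rightarrow> bool" where
  "warped_product3 X Y Z g \<longleftrightarrow>
     warped_product X (Y \<times>\<^sub>M Z) g \<or>
     warped_product (Y \<times>\<^sub>M Z) X (pull_tensor regroup2 regroup2 regroup2 g) \<or>
     warped_product Y (X \<times>\<^sub>M Z) (pull_tensor regroup3 regroup3 regroup3 g) \<or>
     warped_product (X \<times>\<^sub>M Z) Y (pull_tensor regroup4 regroup4 regroup4 g) \<or>
     warped_product (X \<times>\<^sub>M Y) Z (pull_tensor regroup5 regroup5 regroup5 g) \<or>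
     warped_product Z (X \<times>\<^sub>M Y) (pull_tensor regroup6 regroup6 regroup6 g)"

definition proper_warped_product3 ::
    "('a, 'i, 'e::euclidean_space) manifold \<Rightarrow> ('b, 'j, 'f::euclidean_space) manifold \<Rightarrow>
     ('c, 'k, 'g::euclidean_space) manifold \<Rightarrow>
     ('a \<times> 'b \<times> 'c, 'i \<times> 'j \<times> 'k, 'e \<times> 'f \<times> 'g) tensor2 \<Rightarrow> bool" where
  "proper_warped_product3 X Y Z g \<longleftrightarrow>
     proper_warped_product X (Y \<times>\<^sub>M Z) g \<or>
     proper_warped_product (Y \<times>\<^sub>M Z) X (pull_tensor regroup2 regroup2 regroup2 g) \<or>
     proper_warped_product Y (X \<times>\<^sub>M Z) (pull_tensor regroup3 regroup3 regroup3 g) \<or>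
     proper_warped_product (X \<times>\<^sub>M Z) Y (pull_tensor regroup4 regroup4 regroup4 g) \<or>
     proper_warped_product (X \<times>\<^sub>M Y) Z (pull_tensor regroup5 regroup5 regroup5 g) \<or>
     proper_warped_product Z (X \<times>\<^sub>M Y) (pull_tensor regroup6 regroup6 regroup6 g)"

section \<open>The Lorentzian metric and its Riemannian dual\<close>

text \<open>On \<open>circle \<times>\<^sub>M circle \<times>\<^sub>M M\<close>, a tangent vector \<open>(r, s, u)\<close> stands for
  \<open>r \<partial>\<^sub>\<phi> + s \<partial>\<^sub>\<theta> + u\<close>. The function \<open>H\<close> depends on the second circle and on \<open>M\<close> only.\<close>

definition pp_metric ::
    "('a, 'i, 'e) tensor2 \<Rightarrow> (complex \<times> 'a \<Rightarrow> real) \<Rightarrow>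
     (complex \<times> complex \<times> 'a, real \<times> real \<times> 'i, real \<times> real \<times> 'e) tensor2" where
  "pp_metric gR H = (\<lambda>(a, b, k) (z, w, m) (r, s, u) (r', s', u').
     (r * s' + s * r') + H (w, m) * s * s' + gR k m u u')"

definition T_field ::
    "(complex \<times> 'a \<Rightarrow> real) \<Rightarrow>
     (complex \<times> complex \<times> 'a, real \<times> real \<times> 'i, real \<times> real \<times> 'e::euclidean_space) vfield" where
  "T_field H = (\<lambda>c (z, w, m). ((H (w, m) + 1) / 2, -1, 0))"

definition Z_field ::
    "(complex \<times> 'a \<Rightarrow> real) \<Rightarrow>
     (complex \<times> complex \<times> 'a, real \<times> real \<times> 'i, real \<times> real \<times> 'e::euclidean_space) vfield" where
  "Z_field H = (\<lambda>c (z, w, m). ((H (w, m) - 1) / 2, -1, 0))"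

definition dual_metric ::
    "('a, 'i, 'e) tensor2 \<Rightarrow> ('a, 'i, 'e) vfield \<Rightarrow> ('a, 'i, 'e) tensor2" where
  "dual_metric h T = (\<lambda>c p u v. h c p u v + 2 * (h c p (T c p) u * h c p (T c p) v))"

text \<open>The almost complex structure with \<open>JT = Z\<close>, \<open>JZ = -T\<close> and \<open>J = JR\<close> on \<open>TM\<close>, written with the
  \<open>h\<close>-orthonormal expansion \<open>X = -h(X,T) T + h(X,Z) Z + u\<close>; see the lemmas below.\<close>

definition pp_J ::
    "('a, 'i, 'e::euclidean_space) tensor2 \<Rightarrow> ('a, 'i, 'e) endo \<Rightarrow> (complex \<times> 'a \<Rightarrow> real) \<Rightarrow>
     (complex \<times> complex \<times> 'a, real \<times> real \<times> 'i, real \<times> real \<times> 'e) endo" where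
  "pp_J gR JR H = (\<lambda>(a, b, k) (z, w, m) X.
     let c = (a, b, k); p = (z, w, m); h = pp_metric gR H c p; T = T_field H c p; Z = Z_field H c p in
     - h X T *\<^sub>R Z - h X Z *\<^sub>R T + (0, 0, JR k m (snd (snd X))))"

lemma pp_metric_frame:
  assumes "bilinear (gR k m)"
  shows "pp_metric gR H (a, b, k) (z, w, m) (T_field H (a, b, k) (z, w, m)) (T_field H (a, b, k) (z, w, m)) = -1"
    and "pp_metric gR H (a, b, k) (z, w, m) (Z_field H (a, b, k) (z, w, m)) (Z_field H (a, b, k) (z, w, m)) = 1"
    and "pp_metric gR H (a, b, k) (z, w, m) (T_field H (a, b, k) (z, w, m)) (Z_field H (a, b, k) (z, w, m)) = 0"
    and "pp_metric gR H (a, b, k) (z, w, m) (Z_field H (a, b, k) (z, w, m)) (T_field H (a, b, k) (z, w, m)) = 0"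
  using assms
  by (simp_all add: pp_metric_def T_field_def Z_field_def bilinear_lzero field_simps)

lemma pp_J_frame:
  assumes "bilinear (gR k m)" "linear (JR k m)"
  shows "pp_J gR JR H (a, b, k) (z, w, m) (T_field H (a, b, k) (z, w, m)) = Z_field H (a, b, k) (z, w, m)"
    and "pp_J gR JR H (a, b, k) (z, w, m) (Z_field H (a, b, k) (z, w, m)) = - T_field H (a, b, k) (z, w, m)"
    and "pp_J gR JR H (a, b, k) (z, w, m) (0, 0, u) = (0, 0, JR k m u)"
proof -
  have z: "snd (snd (T_field H (a, b, k) (z, w, m))) = 0" "snd (snd (Z_field H (a, b, k) (z, w, m))) = 0"
    by (simp_all add: T_field_def Z_field_def)
  show "pp_J gR JR H (a, b, k) (z, w, m) (T_field H (a, b, k) (z, w, m)) = Z_field H (a, b, k) (z, w, m)"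
    and "pp_J gR JR H (a, b, k) (z, w, m) (Z_field H (a, b, k) (z, w, m)) = - T_field H (a, b, k) (z, w, m)"
    using pp_metric_frame[of gR k m H a b z w, OF assms(1)]
    by (simp_all add: pp_J_def Let_def z linear_0[OF assms(2)] flip: zero_prod_def)
  show "pp_J gR JR H (a, b, k) (z, w, m) (0, 0, u) = (0, 0, JR k m u)"
    using bilinear_rzero[OF assms(1)]
    by (simp add: pp_J_def Let_def pp_metric_def T_field_def Z_field_def)
qed

lemma pp_J_linear:
  assumes "bilinear (gR k m)" "linear (JR k m)"
  shows "linear (pp_J gR JR H (a, b, k) (z, w, m))"
  using assms
  by (intro linearI)
    (auto simp: pp_J_def Let_def pp_metric_def T_field_def Z_field_def bilinear_rzero
       linear_add linear_scale field_simps bilinear_ladd bilinear_lmul)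

text \<open>\<open>X(H) = 0\<close> for every vector \<open>X\<close> tangent to \<open>M\<close>.\<close>

definition constant_on_M :: "('a, 'i, 'e::euclidean_space) manifold \<Rightarrow> (complex \<times> 'a \<Rightarrow> real) \<Rightarrow> bool" where
  "constant_on_M M H \<longleftrightarrow>
     (\<forall>c\<in>ind (circle \<times>\<^sub>M M). \<forall>p\<in>cdom (circle \<times>\<^sub>M M) c. \<forall>u. cderiv (circle \<times>\<^sub>M M) c H p (0, u) = 0)"

end

theory Submission
  imports Defs
begin

text \<open>In coordinates \<open>g\<close> restricts to a metric of determinant 1 on the torus, so its fundamental form is
  \<open>d\<phi> \<and> d\<theta> + \<omega>\<^sub>R\<close>, which does not involve \<open>H\<close> and is closed because \<open>\<omega>\<^sub>R\<close> is. The Nijenhuis tensor of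
  \<open>J\<close> is the one of \<open>J\<^sub>R\<close> plus terms linear in the derivatives of \<open>H\<close> along \<open>M\<close>; on \<open>\<partial>\<^sub>\<phi>\<close> and \<open>v\<close> tangent to
  \<open>M\<close>, its \<open>\<partial>\<^sub>\<theta>\<close> component is \<open>-2 v(H)\<close>. In each of the six
  ways to group the factors some fibre vector has constant length, so the warping function is
  constant; moreover \<open>H = 0\<close> if the two circles are separated, because base and fibre are orthogonal, and
  \<open>H\<close> is constant on \<open>M\<close> otherwise, because it is a component of the metric on the torus factor. Co-closedness with
  respect to \<open>h\<close> is the vanishing divergence of the bivector obtained by raising indices, which is
  inverse to a closed 2-form up to sign; for the inverse of a closed 2-form it follows from Jacobi's
  formula for the derivative of the determinant.\<close>

section \<open>Smooth maps\<close>

text \<open>The claim on warped products splits in two because it cannot hold literally for every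
  \<open>H\<close>: if \<open>H\<close> depends on the second angle only, then \<open>g\<close> is
  the direct product of a metric on the torus and \<open>gR\<close>, that is, a warped product with
  constant warping function. So nonconstant warping functions are excluded always, and all warping
  functions as soon as \<open>H\<close> varies along \<open>M\<close>.

  For a compatible metric, the star of the fundamental form is up to a factorial one of its own
  powers, which gives co-closedness at once. But \<open>h\<close> is not compatible with
  \<open>J\<close>, and its star weights the torus part and the \<open>M\<close> part with opposite
  signs. Inverting a closed 2-form in coordinates needs neither wedge powers nor the signature of
  \<open>h\<close>.

  The components of \<open>g\<close> and \<open>J\<close> are polynomial in \<open>H\<close> and
  linear in those of \<open>gR\<close> and \<open>JR\<close>, so closure of smoothness under linear
  maps, sums and products is enough.\<close>

lemma Ck_on_cong:
  assumes "open S" "\<And>x. x \<in> S \<Longrightarrow> f x = g x"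
  shows "Ck_on k S f \<longleftrightarrow> Ck_on k S g"
  using assms(2)
proof (induction k arbitrary: f g)
  case 0
  then show ?case by (simp cong: continuous_on_cong)
next
  case (Suc k)
  have "f differentiable_on S \<longleftrightarrow> g differentiable_on S"
    using Suc.prems by (simp add: differentiable_on_def differentiable_def)
      (metis (no_types, lifting) has_derivative_transform)
  moreover have "Ck_on k S (\<lambda>x. frechet_derivative f (at x) v) \<longleftrightarrow>
      Ck_on k S (\<lambda>x. frechet_derivative g (at x) v)" for v
  proof (rule Suc.IH)
    fix x assume x: "x \<in> S"
    \<comment> \<open>The derivative is taken \<open>at x\<close> in the whole space, so agreement
      on \<open>S\<close> determines it only because \<open>S\<close> is open.\<close>
    have "(f has_derivative D) (at x) \<longleftrightarrow> (g has_derivative D) (at x)" for D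
      using has_derivative_transform_within_open[OF _ assms(1) x] Suc.prems by metis
    then show "frechet_derivative f (at x) v = frechet_derivative g (at x) v"
      by (simp add: frechet_derivative_def)
  qed
  ultimately show ?case by simp
qed

lemma Ck_on_imp_differentiable:
  assumes "Ck_on (Suc k) S f" "open S" "x \<in> S"
  shows "f differentiable (at x)"
proof -
  have "f differentiable (at x within S)"
    using assms(1,3) by (simp add: differentiable_on_def)
  then show ?thesis
    using at_within_open[OF assms(3,2)] by simp
qed

lemma smooth_on_imp_differentiable:
  assumes "smooth_on S f" "open S" "x \<in> S"
  shows "f differentiable (at x)"
  using assms Ck_on_imp_differentiable[of 0 S f x] unfolding smooth_on_def by blast

lemma Ck_on_Suc_imp_Ck_on: "Ck_on (Suc k) S f \<Longrightarrow> Ck_on k S f"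
  by (induction k arbitrary: f) (auto simp: differentiable_imp_continuous_on)

text \<open>\<open>frechet_derivative\<close> is a choice; with an explicit family \<open>D\<close>
  of derivatives, the inductions below reduce to the ordinary rules of differentiation.\<close>

lemma Ck_on_SucI:
  assumes S: "open S" and D: "\<And>v. Ck_on k S (\<lambda>x. D x v)"
    and d: "\<And>x. x \<in> S \<Longrightarrow> (f has_derivative D x) (at x)"
  shows "Ck_on (Suc k) S f"
proof -
  have "Ck_on k S (\<lambda>x. frechet_derivative f (at x) v)" for v
    using D Ck_on_cong[OF S, of "\<lambda>x. frechet_derivative f (at x) v" "\<lambda>x. D x v" k]
      frechet_derivative_at[OF d] by metis
  moreover have "f differentiable_on S"
    unfolding differentiable_on_def using d differentiable_at_withinI differentiableI by blast
  ultimately show ?thesis by simp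
qed

lemma Ck_on_SucD:
  assumes "Ck_on (Suc k) S f" "open S" "x \<in> S"
  shows "(f has_derivative frechet_derivative f (at x)) (at x)"
  using Ck_on_imp_differentiable[OF assms] frechet_derivative_works by blast

lemma Ck_on_const: "Ck_on k S (\<lambda>x. c)"
  by (induction k arbitrary: c) auto

lemma Ck_on_linear_comp:
  assumes "bounded_linear L" "open S" "Ck_on k S f"
  shows "Ck_on k S (\<lambda>x. L (f x))"
  using assms(3)
proof (induction k arbitrary: f)
  case 0
  then show ?case using assms(1) by (simp add: bounded_linear.continuous_on)
next
  case (Suc k)
  have "Ck_on k S (\<lambda>x. L (frechet_derivative f (at x) v))" for v
    using Suc by simp
  then show ?case
    by (rule Ck_on_SucI[OF assms(2)])
      (rule bounded_linear.has_derivative[OF assms(1) Ck_on_SucD[OF Suc.prems assms(2)]])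
qed

lemma Ck_on_compose_linear:
  assumes "bounded_linear L" "open S" "open S'" "\<And>x. x \<in> S' \<Longrightarrow> L x \<in> S" "Ck_on k S f"
  shows "Ck_on k S' (\<lambda>x. f (L x))"
  using assms(5)
proof (induction k arbitrary: f)
  case 0
  have "continuous_on S' L"
    using assms(1) by (simp add: linear_continuous_on)
  then show ?case
    using 0 assms(4) by (auto intro!: continuous_on_compose2[of S f S' L])
next
  case (Suc k)
  have "Ck_on k S' (\<lambda>x. frechet_derivative f (at (L x)) (L v))" for v
    using Suc.prems by (intro Suc.IH) simp
  then show ?case
    by (rule Ck_on_SucI[OF assms(3)])
      (rule has_derivative_compose[OF bounded_linear_imp_has_derivative[OF assms(1)]
          Ck_on_SucD[OF Suc.prems assms(2) assms(4)]])
qed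

lemma Ck_on_add:
  assumes "open S" "Ck_on k S f" "Ck_on k S g"
  shows "Ck_on k S (\<lambda>x. f x + g x)"
  using assms(2,3)
proof (induction k arbitrary: f g)
  case 0
  then show ?case by (simp add: continuous_on_add)
next
  case (Suc k)
  have "Ck_on k S (\<lambda>x. frechet_derivative f (at x) v + frechet_derivative g (at x) v)" for v
    using Suc by simp
  then show ?case
    by (rule Ck_on_SucI[OF assms(1)])
      (rule has_derivative_add[OF Ck_on_SucD[OF Suc.prems(1) assms(1)]
          Ck_on_SucD[OF Suc.prems(2) assms(1)]])
qed

lemma Ck_on_bilinear:
  assumes "bounded_bilinear B" "open S" "Ck_on k S f" "Ck_on k S g"
  shows "Ck_on k S (\<lambda>x. B (f x) (g x))"
  using assms(3,4)
proof (induction k arbitrary: f g)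
  case 0
  then show ?case using assms(1) by (simp add: bounded_bilinear.continuous_on)
next
  case (Suc k)
  have "Ck_on k S (\<lambda>x. B (f x) (frechet_derivative g (at x) v) + B (frechet_derivative f (at x) v) (g x))"
    for v
    \<comment> \<open>Each summand of the product rule keeps one factor undifferentiated, and this
      factor has to be taken down from order \<open>Suc k\<close> to \<open>k\<close>.\<close>
    using Suc.prems Ck_on_Suc_imp_Ck_on[OF Suc.prems(1)] Ck_on_Suc_imp_Ck_on[OF Suc.prems(2)]
    by (intro Ck_on_add assms(2) Suc.IH) simp_all
  then show ?case
    by (rule Ck_on_SucI[OF assms(2)])
      (rule bounded_bilinear.FDERIV[OF assms(1)
          Ck_on_SucD[OF Suc.prems(1) assms(2)] Ck_on_SucD[OF Suc.prems(2) assms(2)]])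
qed

lemma smooth_on_cong:
  assumes "open S" "\<And>x. x \<in> S \<Longrightarrow> f x = g x"
  shows "smooth_on S f \<longleftrightarrow> smooth_on S g"
proof -
  have "Ck_on k S f \<longleftrightarrow> Ck_on k S g" for k
    using assms by (rule Ck_on_cong)
  then show ?thesis by (simp add: smooth_on_def)
qed

lemma smooth_on_const: "smooth_on S (\<lambda>x. c)"
  by (simp add: smooth_on_def Ck_on_const)

lemma smooth_on_linear_comp:
  "bounded_linear L \<Longrightarrow> open S \<Longrightarrow> smooth_on S f \<Longrightarrow> smooth_on S (\<lambda>x. L (f x))"
  by (simp add: smooth_on_def Ck_on_linear_comp)

lemma smooth_on_compose_linear:
  "bounded_linear L \<Longrightarrow> open S \<Longrightarrow> open S' \<Longrightarrow> (\<And>x. x \<in> S' \<Longrightarrow> L x \<in> S) \<Longrightarrow> smooth_on S f \<Longrightarrow>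
    smooth_on S' (\<lambda>x. f (L x))"
  unfolding smooth_on_def using Ck_on_compose_linear[of L S S'] by blast

lemma smooth_on_add:
  "open S \<Longrightarrow> smooth_on S f \<Longrightarrow> smooth_on S g \<Longrightarrow> smooth_on S (\<lambda>x. f x + g x)"
  by (simp add: smooth_on_def Ck_on_add)

lemma smooth_on_mult:
  fixes f g :: "'a::real_normed_vector \<Rightarrow> real"
  shows "open S \<Longrightarrow> smooth_on S f \<Longrightarrow> smooth_on S g \<Longrightarrow> smooth_on S (\<lambda>x. f x * g x)"
  by (simp add: smooth_on_def Ck_on_bilinear[OF bounded_bilinear_mult])

lemma smooth_on_scaleR:
  "open S \<Longrightarrow> smooth_on S f \<Longrightarrow> smooth_on S g \<Longrightarrow> smooth_on S (\<lambda>x. f x *\<^sub>R g x)"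
  by (simp add: smooth_on_def Ck_on_bilinear[OF bounded_bilinear_scaleR])

section \<open>Charts and derivatives in charts\<close>

text \<open>What calculus inside a single chart needs of a manifold. For the circle and for products
  it is checked directly, without going through \<open>smooth_manifold\<close>.\<close>

definition proper_chart :: "('a, 'i, 'e::euclidean_space) manifold \<Rightarrow> 'i \<Rightarrow> bool" where
  "proper_chart M i \<longleftrightarrow> inj_on (crd M i) (cdom M i) \<and> open (crd M i ` cdom M i)"

text \<open>A relation beside the function \<open>cderiv\<close>, so that derivatives of composite
  expressions can be assembled by introduction rules; \<open>cderiv_eq\<close> leads back to
  \<open>cderiv\<close>.\<close>

definition has_cderiv ::
    "('a, 'i, 'e::euclidean_space) manifold \<Rightarrow> 'i \<Rightarrow> ('a \<Rightarrow> 'b::real_normed_vector) \<Rightarrow> 'a \<Rightarrow> ('e \<Rightarrow> 'b) \<Rightarrow> bool" where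
  "has_cderiv M i f p D \<longleftrightarrow> ((\<lambda>x. f (param M i x)) has_derivative D) (at (crd M i p))"

lemma param_crd: "proper_chart M i \<Longrightarrow> p \<in> cdom M i \<Longrightarrow> param M i (crd M i p) = p"
  by (simp add: param_def proper_chart_def)

lemma param_in_cdom: "x \<in> crd M i ` cdom M i \<Longrightarrow> param M i x \<in> cdom M i"
  by (simp add: param_def inv_into_into)

lemma crd_param: "x \<in> crd M i ` cdom M i \<Longrightarrow> crd M i (param M i x) = x"
  by (simp add: param_def f_inv_into_f)

lemma smooth_manifold_proper_chart: "smooth_manifold M \<Longrightarrow> i \<in> ind M \<Longrightarrow> proper_chart M i"
  unfolding smooth_manifold_def proper_chart_def
  by (auto simp: homeomorphic_eq_everything_map topspace_subtopology dest!: bspec)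
    (metis (no_types, lifting) Int_absorb1 openin_subset)

lemma cderiv_eq: "has_cderiv M i f p D \<Longrightarrow> cderiv M i f p = D"
  unfolding has_cderiv_def cderiv_def using frechet_derivative_at[of "f \<circ> param M i" D "crd M i p"]
  by (auto simp: o_def)

lemma smooth_in_chart_has_cderiv:
  assumes "proper_chart M i" "smooth_in_chart M i f" "p \<in> cdom M i"
  shows "has_cderiv M i f p (cderiv M i f p)"
proof -
  have "(f \<circ> param M i) differentiable (at (crd M i p))"
    using assms by (intro smooth_on_imp_differentiable[of "crd M i ` cdom M i"])
      (auto simp: smooth_in_chart_def proper_chart_def)
  then show ?thesis
    by (simp add: has_cderiv_def cderiv_def[abs_def] frechet_derivative_works o_def)
qed

lemma has_cderiv_linear: "has_cderiv M i f p D \<Longrightarrow> linear D"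
  unfolding has_cderiv_def by (rule has_derivative_linear)

lemma has_cderiv_cong:
  assumes "proper_chart M i" "p \<in> cdom M i" "\<And>q. q \<in> cdom M i \<Longrightarrow> f q = g q" "has_cderiv M i f p D"
  shows "has_cderiv M i g p D"
  unfolding has_cderiv_def
proof (rule has_derivative_transform_within_open)
  show "((\<lambda>x. f (param M i x)) has_derivative D) (at (crd M i p))"
    using assms(4) by (simp add: has_cderiv_def)
  show "open (crd M i ` cdom M i)" using assms(1) by (simp add: proper_chart_def)
  show "crd M i p \<in> crd M i ` cdom M i" using assms(2) by simp
  show "f (param M i x) = g (param M i x)" if "x \<in> crd M i ` cdom M i" for x
    using assms(3) param_in_cdom[OF that] by simp
qed

lemma has_cderiv_const: "has_cderiv M i (\<lambda>q. c) p (\<lambda>v. 0)"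
  by (simp add: has_cderiv_def)

lemma has_cderiv_add:
  "has_cderiv M i f p D \<Longrightarrow> has_cderiv M i g p E \<Longrightarrow> has_cderiv M i (\<lambda>q. f q + g q) p (\<lambda>v. D v + E v)"
  by (simp add: has_cderiv_def has_derivative_add)

lemma has_cderiv_sum:
  "(\<And>b. b \<in> B \<Longrightarrow> has_cderiv M i (f b) p (D b)) \<Longrightarrow>
    has_cderiv M i (\<lambda>q. \<Sum>b\<in>B. f b q) p (\<lambda>v. \<Sum>b\<in>B. D b v)"
  by (simp add: has_cderiv_def has_derivative_sum)

lemma has_cderiv_bounded_linear:
  "bounded_linear L \<Longrightarrow> has_cderiv M i f p D \<Longrightarrow> has_cderiv M i (\<lambda>q. L (f q)) p (\<lambda>v. L (D v))"
  unfolding has_cderiv_def by (rule bounded_linear.has_derivative)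

lemma has_cderiv_bilinear:
  assumes "bounded_bilinear B" "proper_chart M i" "p \<in> cdom M i"
    "has_cderiv M i f p D" "has_cderiv M i g p E"
  shows "has_cderiv M i (\<lambda>q. B (f q) (g q)) p (\<lambda>v. B (f p) (E v) + B (D v) (g p))"
  using bounded_bilinear.FDERIV[OF assms(1) assms(4,5)[unfolded has_cderiv_def]]
  by (simp add: has_cderiv_def param_crd[OF assms(2,3)])

text \<open>The transition map is smooth on the image of the overlap, and a derivative at a point
  requires this image to be open. It is, because a chart is a homeomorphism onto an open set, hence
  an open map.\<close>

lemma smooth_manifold_transition:
  assumes M: "smooth_manifold M" and "i \<in> ind M" "j \<in> ind M" "p \<in> cdom M i \<inter> cdom M j"
  shows "has_cderiv M i (crd M j) p (cderiv M i (crd M j) p)"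
proof -
  let ?U = "cdom M i \<inter> cdom M j"
  have *: "openin (mtop M) (cdom M i)" "openin (mtop M) (cdom M j)" "open (crd M i ` cdom M i)"
    "homeomorphic_map (subtopology (mtop M) (cdom M i)) (top_of_set (crd M i ` cdom M i)) (crd M i)"
    "smooth_on (crd M i ` ?U) (crd M j \<circ> param M i)"
    using assms by (auto simp: smooth_manifold_def)
  have "openin (subtopology (mtop M) (cdom M i)) ?U"
    using *(2) by (simp add: Int_commute openin_subtopology_Int2)
  then have "openin (top_of_set (crd M i ` cdom M i)) (crd M i ` ?U)"
    using homeomorphic_imp_open_map[OF *(4)] by (simp add: open_map_def)
  then have "open (crd M i ` ?U)"
    using *(3) by (simp add: openin_open_eq)
  with *(5) assms(4) have "(crd M j \<circ> param M i) differentiable (at (crd M i p))"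
    by (intro smooth_on_imp_differentiable) auto
  then show ?thesis
    by (simp add: has_cderiv_def cderiv_def[abs_def] frechet_derivative_works o_def)
qed

section \<open>Charts of product manifolds\<close>

lemma prod_manifold_simps [simp]:
  "ind (M \<times>\<^sub>M N) = ind M \<times> ind N"
  "cdom (M \<times>\<^sub>M N) (i, j) = cdom M i \<times> cdom N j"
  "crd (M \<times>\<^sub>M N) (i, j) = map_prod (crd M i) (crd N j)"
  "mtop (M \<times>\<^sub>M N) = prod_topology (mtop M) (mtop N)"
  by (simp_all add: prod_manifold_def)

lemma proper_chart_prod:
  assumes "proper_chart M i" "proper_chart N j"
  shows "proper_chart (M \<times>\<^sub>M N) (i, j)"
  using assms unfolding proper_chart_def
  by (auto simp: map_prod_surj_on[OF refl refl] map_prod_inj_on open_Times)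

lemma param_prod:
  assumes "proper_chart M i" "proper_chart N j"
    and "x \<in> crd M i ` cdom M i" "y \<in> crd N j ` cdom N j"
  shows "param (M \<times>\<^sub>M N) (i, j) (x, y) = (param M i x, param N j y)"
proof -
  have "param (M \<times>\<^sub>M N) (i, j) (crd (M \<times>\<^sub>M N) (i, j) (param M i x, param N j y)) = (param M i x, param N j y)"
    using assms by (intro param_crd proper_chart_prod) (auto simp: param_in_cdom)
  then show ?thesis
    using assms by (simp add: crd_param)
qed

lemma crd_image_prod: "crd (M \<times>\<^sub>M N) (i, j) ` cdom (M \<times>\<^sub>M N) (i, j) = (crd M i ` cdom M i) \<times> (crd N j ` cdom N j)"
  by (simp add: map_prod_surj_on[OF refl refl])

text \<open>The inverse of a product chart splits into the two inverses only on the image of the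
  chart, since \<open>inv_into\<close> is arbitrary elsewhere. That image is open, which is enough
  for derivatives.\<close>

lemma has_cderiv_prod:
  assumes "proper_chart M i" "proper_chart N j" "p \<in> cdom M i" "q \<in> cdom N j"
    and "((\<lambda>z. f (param M i (fst z), param N j (snd z))) has_derivative D) (at (crd M i p, crd N j q))"
  shows "has_cderiv (M \<times>\<^sub>M N) (i, j) f (p, q) D"
  unfolding has_cderiv_def
proof (rule has_derivative_transform_within_open)
  show "((\<lambda>z. f (param M i (fst z), param N j (snd z))) has_derivative D) (at (crd (M \<times>\<^sub>M N) (i, j) (p, q)))"
    using assms(5) by simp
  show "open (crd (M \<times>\<^sub>M N) (i, j) ` cdom (M \<times>\<^sub>M N) (i, j))"
    using proper_chart_prod[OF assms(1,2)] by (simp add: proper_chart_def)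
  show "crd (M \<times>\<^sub>M N) (i, j) (p, q) \<in> crd (M \<times>\<^sub>M N) (i, j) ` cdom (M \<times>\<^sub>M N) (i, j)"
    using assms(3,4) by (intro imageI) simp
  show "f (param M i (fst z), param N j (snd z)) = f (param (M \<times>\<^sub>M N) (i, j) z)"
    if "z \<in> crd (M \<times>\<^sub>M N) (i, j) ` cdom (M \<times>\<^sub>M N) (i, j)" for z
    using that param_prod[OF assms(1,2)] unfolding crd_image_prod by (cases z) auto
qed

lemma has_cderiv_fst:
  assumes "proper_chart M i" "proper_chart N j" "p \<in> cdom M i" "q \<in> cdom N j" "has_cderiv M i f p D"
  shows "has_cderiv (M \<times>\<^sub>M N) (i, j) (\<lambda>z. f (fst z)) (p, q) (\<lambda>v. D (fst v))"
  using assms(5) has_derivative_compose[OF has_derivative_fst[OF has_derivative_ident],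
      of "\<lambda>x. f (param M i x)" D "(crd M i p, crd N j q)" UNIV]
  by (intro has_cderiv_prod assms) (simp_all add: has_cderiv_def)

lemma has_cderiv_snd:
  assumes "proper_chart M i" "proper_chart N j" "p \<in> cdom M i" "q \<in> cdom N j" "has_cderiv N j f q D"
  shows "has_cderiv (M \<times>\<^sub>M N) (i, j) (\<lambda>z. f (snd z)) (p, q) (\<lambda>v. D (snd v))"
  using assms(5) has_derivative_compose[OF has_derivative_snd[OF has_derivative_ident],
      of "\<lambda>x. f (param N j x)" D "(crd M i p, crd N j q)" UNIV]
  by (intro has_cderiv_prod assms) (simp_all add: has_cderiv_def)

lemma has_cderiv_Pair:
  "has_cderiv M i f p D \<Longrightarrow> has_cderiv M i g p E \<Longrightarrow> has_cderiv M i (\<lambda>q. (f q, g q)) p (\<lambda>v. (D v, E v))"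
  by (simp add: has_cderiv_def has_derivative_Pair)

lemma smooth_in_chart_snd:
  assumes "proper_chart M i" "proper_chart N j" "smooth_in_chart N j f"
  shows "smooth_in_chart (M \<times>\<^sub>M N) (i, j) (\<lambda>z. f (snd z))"
proof -
  let ?S = "crd N j ` cdom N j" and ?S' = "crd (M \<times>\<^sub>M N) (i, j) ` cdom (M \<times>\<^sub>M N) (i, j)"
  have o: "open ?S" "open ?S'"
    using assms(2) proper_chart_prod[OF assms(1,2)] by (auto simp: proper_chart_def)
  have "smooth_on ?S' (\<lambda>z. (f \<circ> param N j) (snd z))"
    using assms(3) o
    by (intro smooth_on_compose_linear[OF bounded_linear_snd, of ?S]) (auto simp: smooth_in_chart_def o_def)
  moreover have "((\<lambda>z. f (snd z)) \<circ> param (M \<times>\<^sub>M N) (i, j)) z = (f \<circ> param N j) (snd z)" if "z \<in> ?S'" for z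
    using that param_prod[OF assms(1,2)] unfolding crd_image_prod by (cases z) auto
  ultimately show ?thesis
    unfolding smooth_in_chart_def
    using smooth_on_cong[OF o(2), of "(\<lambda>z. f (snd z)) \<circ> param (M \<times>\<^sub>M N) (i, j)"
        "\<lambda>z. (f \<circ> param N j) (snd z)"] by blast
qed

lemma smooth_in_chart_const: "smooth_in_chart M i (\<lambda>p. c)"
  by (simp add: smooth_in_chart_def smooth_on_const o_def)

lemma smooth_in_chart_add:
  "proper_chart M i \<Longrightarrow> smooth_in_chart M i f \<Longrightarrow> smooth_in_chart M i g \<Longrightarrow> smooth_in_chart M i (\<lambda>p. f p + g p)"
  by (simp add: smooth_in_chart_def smooth_on_add o_def proper_chart_def)

lemma smooth_in_chart_sum:
  "proper_chart M i \<Longrightarrow> (\<And>b. b \<in> B \<Longrightarrow> smooth_in_chart M i (f b)) \<Longrightarrow> smooth_in_chart M i (\<lambda>p. \<Sum>b\<in>B. f b p)"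
  by (induction B rule: infinite_finite_induct) (auto simp: smooth_in_chart_const smooth_in_chart_add)

lemma smooth_in_chart_mult:
  fixes f g :: "'a \<Rightarrow> real"
  shows "proper_chart M i \<Longrightarrow> smooth_in_chart M i f \<Longrightarrow> smooth_in_chart M i g \<Longrightarrow> smooth_in_chart M i (\<lambda>p. f p * g p)"
  by (simp add: smooth_in_chart_def smooth_on_mult o_def proper_chart_def)

lemma smooth_in_chart_scaleR:
  "proper_chart M i \<Longrightarrow> smooth_in_chart M i f \<Longrightarrow> smooth_in_chart M i g \<Longrightarrow> smooth_in_chart M i (\<lambda>p. f p *\<^sub>R g p)"
  by (simp add: smooth_in_chart_def smooth_on_scaleR o_def proper_chart_def)

lemma smooth_in_chart_bounded_linear:
  "proper_chart M i \<Longrightarrow> bounded_linear L \<Longrightarrow> smooth_in_chart M i f \<Longrightarrow> smooth_in_chart M i (\<lambda>p. L (f p))"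
  unfolding smooth_in_chart_def o_def proper_chart_def using smooth_on_linear_comp[of L] by blast

lemma smooth_in_chart_cong:
  assumes "proper_chart M i" "\<And>p. p \<in> cdom M i \<Longrightarrow> f p = g p"
  shows "smooth_in_chart M i f \<longleftrightarrow> smooth_in_chart M i g"
  unfolding smooth_in_chart_def
proof (rule smooth_on_cong)
  show "open (crd M i ` cdom M i)" using assms(1) by (simp add: proper_chart_def)
  show "(f \<circ> param M i) x = (g \<circ> param M i) x" if "x \<in> crd M i ` cdom M i" for x
    using assms(2) param_in_cdom[OF that] by simp
qed

section \<open>The angular charts of the circle\<close>

lemma inj_on_cis: "inj_on cis {a<..<a + 2 * pi}"
proof (rule inj_onI)
  fix x y assume xy: "x \<in> {a<..<a + 2 * pi}" "y \<in> {a<..<a + 2 * pi}" and "cis x = cis y"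
  then have "sin x = sin y \<and> cos x = cos y" by (simp add: complex_eq_iff)
  then obtain n where n: "x = y + 2 * pi * of_int n"
    using sin_cos_eq_iff by (metis mult.assoc mult.commute)
  have "\<bar>2 * pi * of_int n\<bar> < 2 * pi * 1" using xy n by auto
  then have "\<bar>of_int n :: real\<bar> < 1"
    by (simp add: abs_mult)
  then have "n = 0" by linarith
  then show "x = y" using n by simp
qed

lemma circle_simps [simp]:
  "ind circle = UNIV"
  "cdom circle a = cis ` {a<..<a + 2 * pi}"
  "crd circle a = inv_into {a<..<a + 2 * pi} cis"
  "mtop circle = top_of_set (sphere 0 1)"
  by (simp_all add: circle_def)

lemma crd_circle_cis: "x \<in> {a<..<a + 2 * pi} \<Longrightarrow> crd circle a (cis x) = x"
  by (simp add: inj_on_cis inv_into_f_f)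

lemma crd_circle_image: "crd circle a ` cdom circle a = {a<..<a + 2 * pi}"
  using inv_into_image_cancel[OF inj_on_cis[of a] subset_refl]
  by simp

lemma proper_chart_circle: "proper_chart circle a"
  unfolding proper_chart_def crd_circle_image
  by (auto simp: inj_on_inv_into)

lemma param_circle: "x \<in> {a<..<a + 2 * pi} \<Longrightarrow> param circle a x = cis x"
  using param_crd[OF proper_chart_circle, of "cis x" a] crd_circle_cis[of x a] by auto

text \<open>Two angular coordinates differ locally by a constant. This is why the components
  \<open>r\<close> and \<open>s\<close> of a tangent vector of the torus are the same in all
  charts.\<close>

lemma circle_transition:
  assumes "p \<in> cdom circle a" "p \<in> cdom circle b"
  shows "has_cderiv circle a (crd circle b) p (\<lambda>v. v)"
proof -
  obtain x y where x: "x \<in> {a<..<a + 2 * pi}" "p = cis x" and y: "y \<in> {b<..<b + 2 * pi}" "p = cis y"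
    using assms by auto
  \<comment> \<open>The angles in the interval of chart \<open>a\<close> whose shift by
    \<open>y - x\<close> falls into the interval of chart \<open>b\<close>.\<close>
  let ?S = "{a<..<a + 2 * pi} \<inter> {b + (x - y)<..<b + (x - y) + 2 * pi}"
  have "((\<lambda>z. crd circle b (param circle a z)) has_derivative (\<lambda>v. v)) (at x)"
  proof (rule has_derivative_transform_within_open[of "\<lambda>z. z + (y - x)" _ _ _ ?S])
    show "((\<lambda>z. z + (y - x)) has_derivative (\<lambda>v. v)) (at x)"
      by (auto intro!: derivative_eq_intros)
    show "z + (y - x) = crd circle b (param circle a z)" if "z \<in> ?S" for z
    proof -
      have "cis (z + (y - x)) = cis z * cis y / cis x" by (simp add: cis_divide cis_mult add_diff_eq)
      also have "\<dots> = cis z" using x y by simp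
      finally have "param circle a z = cis (z + (y - x))"
        using that by (simp add: param_circle)
      moreover have "crd circle b (cis (z + (y - x))) = z + (y - x)"
        using that by (intro crd_circle_cis) auto
      ultimately show ?thesis by metis
    qed
  qed (use x y in \<open>auto simp del: circle_simps\<close>)
  then show ?thesis
    using crd_circle_cis[OF x(1)] x(2) by (simp add: has_cderiv_def)
qed

section \<open>The Nijenhuis tensor\<close>

lemma linear_expand:
  fixes x :: "'e::euclidean_space"
  assumes "linear A"
  shows "A x = (\<Sum>c\<in>Basis. inner x c *\<^sub>R A c)"
  using linear_sum[OF assms, of "\<lambda>c. inner x c *\<^sub>R c" Basis]
  by (simp add: euclidean_representation linear_scale[OF assms])

text \<open>The value at \<open>p\<close> of the Nijenhuis tensor, computed from the derivatives of \<open>J\<close> alone.\<close>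

definition nij_at ::
    "('a, 'i, 'e::euclidean_space) manifold \<Rightarrow> ('a, 'i, 'e) endo \<Rightarrow> 'i \<Rightarrow> 'a \<Rightarrow> 'e \<Rightarrow> 'e \<Rightarrow> 'e" where
  "nij_at M J i p u v =
     (let D = \<lambda>w x. cderiv M i (\<lambda>q. J i q x) p w in
      D (J i p u) v - D (J i p v) u + J i p (D v u) - J i p (D u v))"

text \<open>Both \<open>J\<close> and its argument vary with the point. Expanding the argument in
  the basis leaves products of scalar functions with \<open>J\<close> on fixed vectors, where the
  product rule applies.\<close>

lemma has_cderiv_endo_apply:
  fixes M :: "('a, 'i, 'e::euclidean_space) manifold" and J :: "('a, 'i, 'e) endo"
  assumes "proper_chart M i" "p \<in> cdom M i"
    and J: "\<And>q. q \<in> cdom M i \<Longrightarrow> linear (J i q)"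
      "\<And>x. has_cderiv M i (\<lambda>q. J i q x) p (\<lambda>w. cderiv M i (\<lambda>q. J i q x) p w)"
    and a: "has_cderiv M i a p A"
  shows "has_cderiv M i (\<lambda>q. J i q (a q)) p (\<lambda>w. J i p (A w) + cderiv M i (\<lambda>q. J i q (a p)) p w)"
proof -
  let ?D = "\<lambda>c w. cderiv M i (\<lambda>q. J i q c) p w"
  have expand: "has_cderiv M i (\<lambda>q. \<Sum>c\<in>Basis. inner (b q) c *\<^sub>R J i q c) p
      (\<lambda>w. \<Sum>c\<in>Basis. inner (b p) c *\<^sub>R ?D c w + inner (B w) c *\<^sub>R J i p c)"
    if "has_cderiv M i b p B" for b B
    by (intro has_cderiv_sum has_cderiv_bilinear[OF bounded_bilinear_scaleR] assms(1,2) J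
        has_cderiv_bounded_linear[OF bounded_linear_inner_left] that)
  have *: "has_cderiv M i (\<lambda>q. J i q (b q)) p
      (\<lambda>w. \<Sum>c\<in>Basis. inner (b p) c *\<^sub>R ?D c w + inner (B w) c *\<^sub>R J i p c)"
    if "has_cderiv M i b p B" for b B
    by (rule has_cderiv_cong[OF assms(1,2) linear_expand[OF J(1), symmetric] expand[OF that]])
  \<comment> \<open>The same formula for the constant field with value \<open>a p\<close> shows that
    the derivative of \<open>J\<close> on a fixed vector is linear in that vector.\<close>
  have "?D (a p) w = (\<Sum>c\<in>Basis. inner (a p) c *\<^sub>R ?D c w)" for w
    using cderiv_eq[OF *[OF has_cderiv_const[of M i "a p" p]]] by simp
  then have "(\<Sum>c\<in>Basis. inner (a p) c *\<^sub>R ?D c w + inner (A w) c *\<^sub>R J i p c) =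
      J i p (A w) + ?D (a p) w" for w
    using linear_expand[OF J(1)[OF assms(2)], of "A w"] by (simp add: sum.distrib)
  with *[OF a] show ?thesis by simp
qed

text \<open>Tensoriality: by the product rule every derivative of \<open>a\<close> or
  \<open>b\<close> occurs twice with opposite signs, partly after \<open>J J = -1\<close>, so only
  derivatives of \<open>J\<close> survive.\<close>

lemma nijenhuis_eq_nij_at:
  fixes M :: "('a, 'i, 'e::euclidean_space) manifold" and J :: "('a, 'i, 'e) endo"
  assumes "proper_chart M i" "p \<in> cdom M i"
    and J: "\<And>q. q \<in> cdom M i \<Longrightarrow> linear (J i q)" "\<And>u. J i p (J i p u) = - u"
      "\<And>x. smooth_in_chart M i (\<lambda>q. J i q x)"
    and a: "smooth_in_chart M i a" and b: "smooth_in_chart M i b"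
  shows "nijenhuis M J i a b p = nij_at M J i p (a p) (b p)"
proof -
  note d = smooth_in_chart_has_cderiv[OF assms(1) _ assms(2)]
  have D: "cderiv M i (\<lambda>q. J i q (c q)) p w = J i p (cderiv M i c p w) + cderiv M i (\<lambda>q. J i q (c p)) p w"
    if "smooth_in_chart M i c" for c w
    using cderiv_eq[OF has_cderiv_endo_apply[of M i p J, OF assms(1,2) J(1) d[OF J(3)] d[OF that]]] by simp
  have l: "J i p (x + y) = J i p x + J i p y" "J i p (x - y) = J i p x - J i p y"
    "J i p (- x) = - J i p x" for x y
    using J(1)[OF assms(2)] by (simp_all add: linear_add linear_diff linear_neg)
  show ?thesis
    by (simp add: nijenhuis_def lie_bracket_def nij_at_def Let_def D[OF a] D[OF b] l J(2) algebra_simps)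
qed

text \<open>Constant coordinate fields are smooth in the chart and take any prescribed pair of
  values, so by tensoriality they are enough to test integrability.\<close>

lemma integrable_acs_iff:
  assumes "\<And>i. i \<in> ind M \<Longrightarrow> proper_chart M i" and J: "almost_complex M J"
  shows "integrable_acs M J \<longleftrightarrow> (\<forall>i\<in>ind M. \<forall>p\<in>cdom M i. \<forall>u v. nij_at M J i p u v = 0)"
proof -
  have *: "nijenhuis M J i a b p = nij_at M J i p (a p) (b p)"
    if "i \<in> ind M" "p \<in> cdom M i" "smooth_in_chart M i a" "smooth_in_chart M i b" for i p a b
    using J that by (intro nijenhuis_eq_nij_at assms(1)) (auto simp: almost_complex_def)
  show ?thesis
  proof
    assume I: "integrable_acs M J"
    have "nij_at M J i p u v = 0" if "i \<in> ind M" "p \<in> cdom M i" for i p u v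
      using I *[OF that smooth_in_chart_const[of M i u] smooth_in_chart_const[of M i v]] that
      by (auto simp: integrable_acs_def smooth_in_chart_const)
    then show "\<forall>i\<in>ind M. \<forall>p\<in>cdom M i. \<forall>u v. nij_at M J i p u v = 0" by blast
  next
    assume "\<forall>i\<in>ind M. \<forall>p\<in>cdom M i. \<forall>u v. nij_at M J i p u v = 0"
    then show "integrable_acs M J" by (simp add: integrable_acs_def *)
  qed
qed

section \<open>Derivatives of determinants and inverse matrices\<close>

text \<open>The cofactors along row \<open>i\<close> do not involve row \<open>i\<close>, so they
  are those of \<open>A\<close>.\<close>

lemma det_replace_row:
  fixes A :: "'a::comm_ring_1 Matrix.mat"
  assumes A: "A \<in> carrier_mat n n" and i: "i < n"
  shows "Determinant.det (Matrix.mat n n (\<lambda>(k, j). if k = i then b j else A $$ (k, j))) =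
    (\<Sum>j<n. b j * cofactor A i j)"
proof -
  let ?B = "Matrix.mat n n (\<lambda>(k, j). if k = i then b j else A $$ (k, j))"
  have "Determinant.det ?B = (\<Sum>j<n. ?B $$ (i, j) * cofactor ?B i j)"
    by (rule laplace_expansion_row) (use i in auto)
  also have "\<dots> = (\<Sum>j<n. b j * cofactor A i j)"
  proof (rule sum.cong[OF refl])
    fix j assume j: "j \<in> {..<n}"
    have "mat_delete ?B i j = mat_delete A i j"
      using A i j by (intro eq_matI) (auto simp: mat_delete_def)
    then show "?B $$ (i, j) * cofactor ?B i j = b j * cofactor A i j"
      using i j by (simp add: cofactor_def)
  qed
  finally show ?thesis .
qed

text \<open>Jacobi's formula in cofactor form, which also covers singular matrices. In the Leibniz
  expansion, the terms in which row \<open>i\<close> is differentiated add up to the determinant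
  with row \<open>i\<close> replaced by its derivative.\<close>

lemma has_derivative_det:
  fixes a :: "'v::real_normed_vector \<Rightarrow> nat \<Rightarrow> nat \<Rightarrow> real"
  assumes d: "\<And>i j. i < n \<Longrightarrow> j < n \<Longrightarrow> ((\<lambda>x. a x i j) has_derivative a' i j) (at x)"
  shows "((\<lambda>x. Determinant.det (Matrix.mat n n (\<lambda>(i, j). a x i j))) has_derivative
    (\<lambda>v. \<Sum>i<n. \<Sum>j<n. a' i j v * cofactor (Matrix.mat n n (\<lambda>(i, j). a x i j)) i j)) (at x)"
proof -
  let ?A = "\<lambda>x. Matrix.mat n n (\<lambda>(i, j). a x i j)"
  let ?P = "{p. p permutes {0..<n}}"
  have lt: "p i < n" if "p \<in> ?P" "i < n" for p i
    using that permutes_in_image[of p "{0..<n}" i] by auto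
  have det: "Determinant.det (?A y) = (\<Sum>p\<in>?P. signof p * (\<Prod>i\<in>{0..<n}. a y i (p i)))" for y
    by (subst det_def'[of _ n]) (auto intro!: sum.cong prod.cong simp: lt)
  have "((\<lambda>y. \<Sum>p\<in>?P. signof p * (\<Prod>i\<in>{0..<n}. a y i (p i))) has_derivative
      (\<lambda>v. \<Sum>p\<in>?P. signof p * (\<Sum>i\<in>{0..<n}. a' i (p i) v * (\<Prod>k\<in>{0..<n} - {i}. a x k (p k))))) (at x)"
    by (intro has_derivative_sum has_derivative_mult_right has_derivative_prod d) (auto simp: lt)
  moreover have "(\<Sum>p\<in>?P. signof p * (\<Sum>i\<in>{0..<n}. a' i (p i) v * (\<Prod>k\<in>{0..<n} - {i}. a x k (p k)))) =
      (\<Sum>i<n. \<Sum>j<n. a' i j v * cofactor (?A x) i j)" for v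
  proof -
    have "(\<Sum>j<n. a' i j v * cofactor (?A x) i j) =
        (\<Sum>p\<in>?P. signof p * (a' i (p i) v * (\<Prod>k\<in>{0..<n} - {i}. a x k (p k))))" if i: "i < n" for i
    proof -
      let ?B = "Matrix.mat n n (\<lambda>(k, j). if k = i then a' i j v else ?A x $$ (k, j))"
      have "(\<Sum>j<n. a' i j v * cofactor (?A x) i j) = Determinant.det ?B"
        by (rule det_replace_row[symmetric]) (use i in auto)
      also have "\<dots> = (\<Sum>p\<in>?P. signof p * (\<Prod>k\<in>{0..<n}. ?B $$ (k, p k)))"
        by (rule det_def') auto
      also have "\<dots> = (\<Sum>p\<in>?P. signof p * (a' i (p i) v * (\<Prod>k\<in>{0..<n} - {i}. a x k (p k))))"
      proof (rule sum.cong[OF refl])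
        fix p assume p: "p \<in> ?P"
        have "(\<Prod>k\<in>{0..<n}. ?B $$ (k, p k)) = ?B $$ (i, p i) * (\<Prod>k\<in>{0..<n} - {i}. ?B $$ (k, p k))"
          using i by (intro prod.remove) auto
        also have "(\<Prod>k\<in>{0..<n} - {i}. ?B $$ (k, p k)) = (\<Prod>k\<in>{0..<n} - {i}. a x k (p k))"
          using p by (intro prod.cong) (auto simp: lt)
        finally show "signof p * (\<Prod>k\<in>{0..<n}. ?B $$ (k, p k)) =
            signof p * (a' i (p i) v * (\<Prod>k\<in>{0..<n} - {i}. a x k (p k)))"
          using p i by (simp add: lt)
      qed
      finally show ?thesis .
    qed
    then have "(\<Sum>i<n. \<Sum>j<n. a' i j v * cofactor (?A x) i j) =
        (\<Sum>i<n. \<Sum>p\<in>?P. signof p * (a' i (p i) v * (\<Prod>k\<in>{0..<n} - {i}. a x k (p k))))"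
      by simp
    also have "\<dots> = (\<Sum>p\<in>?P. \<Sum>i<n. signof p * (a' i (p i) v * (\<Prod>k\<in>{0..<n} - {i}. a x k (p k))))"
      by (rule sum.swap)
    finally show ?thesis by (simp add: sum_distrib_left atLeast0LessThan)
  qed
  ultimately show ?thesis unfolding det by simp
qed

text \<open>Multiply \<open>adj A * A = det A\<close> by \<open>Q\<close> on the right. The indices
  are exchanged because the adjugate is the transposed matrix of cofactors.\<close>

lemma cofactor_eq_inverse:
  fixes A Q :: "'a::comm_ring_1 Matrix.mat"
  assumes "A \<in> carrier_mat n n" "Q \<in> carrier_mat n n" "A * Q = 1\<^sub>m n" "i < n" "j < n"
  shows "cofactor A i j = Determinant.det A * Q $$ (j, i)"
proof -
  have "adj_mat A = adj_mat A * (A * Q)"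
    using assms adj_mat(1)[OF assms(1)] by simp
  also have "\<dots> = adj_mat A * A * Q"
    using assms(1,2) adj_mat(1)[OF assms(1)] by (simp add: assoc_mult_mat)
  also have "\<dots> = Determinant.det A \<cdot>\<^sub>m Q"
    using assms(1,2) adj_mat(3)[OF assms(1)] by (simp add: mult_smult_assoc_mat[of _ n n])
  finally have "adj_mat A $$ (j, i) = (Determinant.det A \<cdot>\<^sub>m Q) $$ (j, i)" by simp
  then show ?thesis using assms by (simp add: adj_mat_def)
qed

text \<open>The entries \<open>q\<close> of the inverse are not assumed differentiable. Cramer's
  rule writes them as quotients of determinants; after that, differentiating \<open>a q = 1\<close>
  gives the familiar formula.\<close>

lemma has_derivative_matrix_inverse:
  fixes a q :: "'v::real_normed_vector \<Rightarrow> nat \<Rightarrow> nat \<Rightarrow> real"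
  assumes d: "\<And>i j. i < n \<Longrightarrow> j < n \<Longrightarrow> ((\<lambda>x. a x i j) has_derivative a' i j) (at x)"
    and S: "open S" "x \<in> S"
    and inv: "\<And>y i k. y \<in> S \<Longrightarrow> i < n \<Longrightarrow> k < n \<Longrightarrow> (\<Sum>j<n. a y i j * q y j k) = (if i = k then 1 else 0)"
    and ij: "i < n" "j < n"
  shows "((\<lambda>y. q y i j) has_derivative (\<lambda>v. - (\<Sum>k<n. \<Sum>l<n. q x i k * a' k l v * q x l j))) (at x)"
proof -
  let ?A = "\<lambda>x. Matrix.mat n n (\<lambda>(i, j). a x i j)" and ?Q = "\<lambda>x. Matrix.mat n n (\<lambda>(i, j). q x i j)"
  have AQ: "?A y * ?Q y = 1\<^sub>m n" if "y \<in> S" for y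
    using inv[OF that] by (intro eq_matI) (auto simp: scalar_prod_def atLeast0LessThan)
  then have QA: "?Q y * ?A y = 1\<^sub>m n" if "y \<in> S" for y
    using that by (intro mat_mult_left_right_inverse[of "?A y"]) auto
  have det0: "Determinant.det (?A y) \<noteq> 0" if "y \<in> S" for y
  proof -
    have "Determinant.det (?A y) * Determinant.det (?Q y) = 1"
      using AQ[OF that] by (metis det_mult det_one mat_carrier)
    then show ?thesis by auto
  qed
  have q_eq: "q y i j = cofactor (?A y) j i / Determinant.det (?A y)" if "y \<in> S" "i < n" "j < n" for y i j
    using cofactor_eq_inverse[OF _ _ AQ[OF that(1)] that(3,2)] det0[OF that(1)] that by simp
  have diff: "(\<lambda>y. q y i j) differentiable (at x)" if "i < n" "j < n" for i j
  proof -
    \<comment> \<open>The index in the full matrix of row or column \<open>k\<close> of a minor that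
      omits row or column \<open>i\<close>.\<close>
    let ?s = "\<lambda>k i::nat. if k < i then k else Suc k"
    have "mat_delete (?A y) j i = Matrix.mat (n - 1) (n - 1) (\<lambda>(k, l). a y (?s k j) (?s l i))" for y
      by (intro eq_matI) (auto simp: mat_delete_def)
    moreover have "((\<lambda>y. Determinant.det (Matrix.mat (n - 1) (n - 1) (\<lambda>(k, l). a y (?s k j) (?s l i)))) has_derivative
        (\<lambda>v. \<Sum>k<n-1. \<Sum>l<n-1. a' (?s k j) (?s l i) v *
          cofactor (Matrix.mat (n-1) (n-1) (\<lambda>(k, l). a x (?s k j) (?s l i))) k l)) (at x)"
      by (rule has_derivative_det[where a = "\<lambda>y k l. a y (?s k j) (?s l i)"]) (intro d; auto)
    ultimately have "(\<lambda>y. cofactor (?A y) j i) differentiable (at x)"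
      unfolding cofactor_def by (auto simp: differentiable_def intro!: exI has_derivative_mult_right)
    moreover have "(\<lambda>y. Determinant.det (?A y)) differentiable (at x)"
      using has_derivative_det[of n a a' x] d by (auto simp: differentiable_def)
    ultimately have "(\<lambda>y. cofactor (?A y) j i / Determinant.det (?A y)) differentiable (at x)"
      by (intro differentiable_divide det0 S)
    then obtain D where "((\<lambda>y. cofactor (?A y) j i / Determinant.det (?A y)) has_derivative D) (at x)"
      by (auto simp: differentiable_def)
    then have "((\<lambda>y. q y i j) has_derivative D) (at x)"
      by (rule has_derivative_transform_within_open[OF _ S]) (simp add: q_eq that)
    then show ?thesis by (rule differentiableI)
  qed
  define q' where "q' = (\<lambda>i j. frechet_derivative (\<lambda>y. q y i j) (at x))"
  have q': "((\<lambda>y. q y i j) has_derivative q' i j) (at x)" if "i < n" "j < n" for i j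
    using diff[OF that] by (simp add: q'_def frechet_derivative_works)
  have inv': "(\<Sum>j<n. q x i j * a x j k) = (if i = k then 1 else 0)" if "i < n" "k < n" for i k
  proof -
    have "(?Q x * ?A x) $$ (i, k) = (1\<^sub>m n :: real Matrix.mat) $$ (i, k)" using QA[OF S(2)] by simp
    then show ?thesis using that by (simp add: scalar_prod_def atLeast0LessThan)
  qed
  have product_rule: "(\<Sum>l<n. a x k l * q' l j v + a' k l v * q x l j) = 0" if "k < n" for k v
  proof -
    have "((\<lambda>y. \<Sum>l<n. a y k l * q y l j) has_derivative (\<lambda>v. \<Sum>l<n. a x k l * q' l j v + a' k l v * q x l j)) (at x)"
      using that ij by (intro has_derivative_sum has_derivative_mult d q') auto
    moreover have "((\<lambda>y. \<Sum>l<n. a y k l * q y l j) has_derivative (\<lambda>v. 0)) (at x)"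
      by (rule has_derivative_transform_within_open[OF has_derivative_const[of "if k = j then 1 else 0"] S])
        (simp add: inv[OF _ that ij(2)])
    ultimately have "(\<lambda>v. \<Sum>l<n. a x k l * q' l j v + a' k l v * q x l j) = (\<lambda>v. 0)"
      by (rule has_derivative_unique)
    then show ?thesis by (rule fun_cong)
  qed
  have "q' i j v = - (\<Sum>k<n. \<Sum>l<n. q x i k * a' k l v * q x l j)" for v
  proof -
    have "q' i j v = (\<Sum>l<n. (if i = l then 1 else 0) * q' l j v)"
      using ij by (simp add: if_distrib[of "\<lambda>c. c * _"] cong: if_cong)
    also have "\<dots> = (\<Sum>l<n. (\<Sum>k<n. q x i k * a x k l) * q' l j v)"
      using ij by (intro sum.cong) (auto simp: inv')
    also have "\<dots> = (\<Sum>l<n. \<Sum>k<n. q x i k * (a x k l * q' l j v))"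
      by (simp add: sum_distrib_right mult.assoc)
    also have "\<dots> = (\<Sum>k<n. \<Sum>l<n. q x i k * (a x k l * q' l j v))" by (rule sum.swap)
    also have "\<dots> = (\<Sum>k<n. q x i k * (\<Sum>l<n. a x k l * q' l j v))"
      by (simp add: sum_distrib_left)
    also have "\<dots> = (\<Sum>k<n. q x i k * (- (\<Sum>l<n. a' k l v * q x l j)))"
    proof (rule sum.cong[OF refl])
      fix k assume "k \<in> {..<n}"
      then have "(\<Sum>l<n. a x k l * q' l j v) = - (\<Sum>l<n. a' k l v * q x l j)"
        using product_rule[of k v] by (simp add: sum.distrib eq_neg_iff_add_eq_0)
      then show "q x i k * (\<Sum>l<n. a x k l * q' l j v) = q x i k * (- (\<Sum>l<n. a' k l v * q x l j))"
        by simp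
    qed
    finally show ?thesis by (simp add: sum_distrib_left sum_negf mult.assoc)
  qed
  then have "q' i j = (\<lambda>v. - (\<Sum>k<n. \<Sum>l<n. q x i k * a' k l v * q x l j))"
    by (rule ext)
  with q'[OF ij] show ?thesis by simp
qed

text \<open>The sign of \<open>d\<close> in the denominator makes one formula serve both signs. In
  this shape the factor \<open>1 / d\<close> cancels the determinant that Jacobi's formula
  produces.\<close>

lemma DERIV_sqrt_abs:
  fixes d :: real
  assumes "d \<noteq> 0"
  shows "((\<lambda>u. sqrt \<bar>u\<bar>) has_real_derivative sqrt \<bar>d\<bar> / (2 * d)) (at d)"
proof (cases "d > 0")
  case True
  have "(sqrt has_real_derivative sqrt \<bar>d\<bar> / (2 * d)) (at d)"
    using True by (auto intro!: derivative_eq_intros simp: field_simps)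
  then show ?thesis
    by (rule has_field_derivative_transform_within_open[of _ _ _ "{0<..}"]) (use True in auto)
next
  case False
  then have d: "d < 0" using assms by simp
  have "((\<lambda>u. sqrt (- u)) has_real_derivative sqrt \<bar>d\<bar> / (2 * d)) (at d)"
    using d by (auto intro!: derivative_eq_intros simp: field_simps)
  then show ?thesis
    by (rule has_field_derivative_transform_within_open[of _ _ _ "{..<0}"]) (use d in auto)
qed

text \<open>Liouville's theorem in coordinates: for a closed nondegenerate 2-form \<open>w\<close>,
  the columns of its inverse \<open>q\<close> are up to sign the Hamiltonian fields of the
  coordinate functions, and \<open>sqrt |det w|\<close> is the symplectic volume density, which
  Hamiltonian flows preserve.\<close>

lemma sqrt_det_inverse_divergence_free:
  fixes w q :: "'v::real_normed_vector \<Rightarrow> nat \<Rightarrow> nat \<Rightarrow> real"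
  assumes d: "\<And>i j. i < n \<Longrightarrow> j < n \<Longrightarrow> ((\<lambda>x. w x i j) has_derivative w' i j) (at x)"
    and S: "open S" "x \<in> S"
    and inv: "\<And>y i k. y \<in> S \<Longrightarrow> i < n \<Longrightarrow> k < n \<Longrightarrow> (\<Sum>j<n. w y i j * q y j k) = (if i = k then 1 else 0)"
    and skew: "\<And>y i j. y \<in> S \<Longrightarrow> i < n \<Longrightarrow> j < n \<Longrightarrow> w y j i = - w y i j"
      "\<And>i j. i < n \<Longrightarrow> j < n \<Longrightarrow> q x j i = - q x i j"
    and closed: "\<And>i j k. i < n \<Longrightarrow> j < n \<Longrightarrow> k < n \<Longrightarrow> w' i j (e k) + w' j k (e i) + w' k i (e j) = 0"
  obtains F' where
    "\<And>i j. i < n \<Longrightarrow> j < n \<Longrightarrow>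
      ((\<lambda>y. sqrt \<bar>Determinant.det (Matrix.mat n n (\<lambda>(i, j). w y i j))\<bar> * q y i j) has_derivative F' i j) (at x)"
    "\<And>j. j < n \<Longrightarrow> (\<Sum>i<n. F' i j (e i)) = 0"
proof -
  let ?W = "\<lambda>y. Matrix.mat n n (\<lambda>(i, j). w y i j)" and ?Q = "\<lambda>y. Matrix.mat n n (\<lambda>(i, j). q y i j)"
  define s where "s = sqrt \<bar>Determinant.det (?W x)\<bar>"
  \<comment> \<open>The trace of \<open>q\<close> times the derivative of \<open>w\<close>: the
    logarithmic derivative of the determinant.\<close>
  define t where "t = (\<lambda>v. \<Sum>i<n. \<Sum>j<n. w' i j v * q x j i)"
  define q' where "q' = (\<lambda>i j v. - (\<Sum>k<n. \<Sum>l<n. q x i k * w' k l v * q x l j))"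
  have WQ: "?W x * ?Q x = 1\<^sub>m n"
    using inv[OF S(2)] by (intro eq_matI) (auto simp: scalar_prod_def atLeast0LessThan)
  then have "Determinant.det (?W x) * Determinant.det (?Q x) = 1"
    by (metis det_mult det_one mat_carrier)
  then have det0: "Determinant.det (?W x) \<noteq> 0" by auto
  have "(\<Sum>i<n. \<Sum>j<n. w' i j v * cofactor (?W x) i j) = Determinant.det (?W x) * t v" for v
    unfolding t_def sum_distrib_left using cofactor_eq_inverse[OF _ _ WQ]
    by (intro sum.cong) auto
  then have "((\<lambda>y. Determinant.det (?W y)) has_derivative (\<lambda>v. Determinant.det (?W x) * t v)) (at x)"
    using has_derivative_det[of n w w' x] d by simp
  from has_derivative_compose[OF this DERIV_sqrt_abs[OF det0, unfolded has_field_derivative_def]]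
  have "((\<lambda>y. sqrt \<bar>Determinant.det (?W y)\<bar>) has_derivative (\<lambda>v. s * t v / 2)) (at x)"
    using det0 by (simp add: s_def field_simps)
  moreover have "((\<lambda>y. q y i j) has_derivative q' i j) (at x)" if "i < n" "j < n" for i j
    using has_derivative_matrix_inverse[of n w w' x S q, OF d S inv that] by (simp add: q'_def)
  ultimately have "((\<lambda>y. sqrt \<bar>Determinant.det (?W y)\<bar> * q y i j) has_derivative
      (\<lambda>v. s * q' i j v + s * t v / 2 * q x i j)) (at x)" if "i < n" "j < n" for i j
    unfolding s_def using that by (intro has_derivative_mult) auto
  moreover have "(\<Sum>i<n. s * q' i j (e i) + s * t (e i) / 2 * q x i j) = 0" if j: "j < n" for j
  proof -
    define X where "X = (\<lambda>l. \<Sum>k<n. \<Sum>m<n. w' k m (e l) * q x m k)"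
    define Y where "Y = (\<lambda>l. \<Sum>i<n. \<Sum>k<n. q x i k * w' k l (e i))"
    have w'_skew: "w' l k v = - w' k l v" if "k < n" "l < n" for k l v
    proof -
      have "((\<lambda>y. w y l k) has_derivative (\<lambda>v. - w' k l v)) (at x)"
        by (rule has_derivative_transform_within_open[OF has_derivative_minus[OF d[OF that]] S])
          (simp add: skew(1)[OF _ that])
      from has_derivative_unique[OF d[OF that(2,1)] this] show ?thesis by (rule fun_cong)
    qed
    \<comment> \<open>Contracting \<open>dw = 0\<close> with the skew \<open>q\<close> makes the
      trace term \<open>X\<close> twice the divergence term \<open>Y\<close>. This factor cancels
      the 1/2 from the square root.\<close>
    have XY: "X l = 2 * Y l" if l: "l < n" for l
    proof -
      have "w' k m (e l) * q x m k = q x k m * w' m l (e k) + q x m k * w' k l (e m)"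
        if "k < n" "m < n" for k m
      proof -
        have closed': "w' k m (e l) = w' k l (e m) - w' m l (e k)"
          using closed[OF that l] w'_skew[OF that(1) l, of "e m"] by simp
        show ?thesis
          unfolding closed' skew(2)[OF that(2,1)] by (simp add: algebra_simps)
      qed
      then have "X l = (\<Sum>k<n. \<Sum>m<n. q x k m * w' m l (e k)) + (\<Sum>k<n. \<Sum>m<n. q x m k * w' k l (e m))"
        by (simp add: X_def sum.distrib)
      also have "(\<Sum>k<n. \<Sum>m<n. q x m k * w' k l (e m)) = Y l"
        unfolding Y_def by (rule sum.swap)
      finally show ?thesis by (simp add: Y_def)
    qed
    have "(\<Sum>i<n. q' i j (e i)) = - (\<Sum>i<n. \<Sum>k<n. \<Sum>l<n. q x i k * w' k l (e i) * q x l j)"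
      by (simp add: q'_def sum_negf)
    also have "(\<Sum>i<n. \<Sum>k<n. \<Sum>l<n. q x i k * w' k l (e i) * q x l j) =
        (\<Sum>i<n. \<Sum>l<n. \<Sum>k<n. q x i k * w' k l (e i) * q x l j)"
      by (intro sum.cong refl sum.swap)
    also have "\<dots> = (\<Sum>l<n. \<Sum>i<n. \<Sum>k<n. q x i k * w' k l (e i) * q x l j)"
      by (rule sum.swap)
    also have "\<dots> = (\<Sum>l<n. Y l * q x l j)"
      by (simp add: Y_def sum_distrib_right)
    finally have "(\<Sum>i<n. q' i j (e i)) = - (\<Sum>l<n. Y l * q x l j)" .
    moreover have "(\<Sum>i<n. t (e i) * q x i j) = 2 * (\<Sum>l<n. Y l * q x l j)"
      unfolding sum_distrib_left using XY by (intro sum.cong) (auto simp: t_def X_def)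
    moreover have "(\<Sum>i<n. s * q' i j (e i) + s * t (e i) / 2 * q x i j) =
        s * (\<Sum>i<n. q' i j (e i)) + s / 2 * (\<Sum>i<n. t (e i) * q x i j)"
      by (simp add: sum.distrib sum_distrib_left mult_ac)
    ultimately show ?thesis by simp
  qed
  ultimately show ?thesis by (rule that)
qed

section \<open>Alternating sums over an enumerated basis\<close>

lemma sum_Basis_nth:
  assumes "distinct bs" "set bs = (Basis :: 'e::euclidean_space set)"
  shows "sum f (Basis :: 'e set) = (\<Sum>k<DIM('e). f (bs ! k))"
proof -
  have "length bs = DIM('e)" using assms distinct_card by force
  then show ?thesis
    using sum.reindex_bij_betw[OF bij_betw_nth[OF assms(1) refl refl], of f] assms(2)
    by (simp add: atLeast0LessThan)
qed

text \<open>The sum is the exterior product of \<open>lam\<close> with the volume form, a form of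
  degree one more than the dimension. In matrix terms, it is the expansion along the first column of
  a determinant whose first column, \<open>lam\<close>, is a combination of the coordinate
  columns.\<close>

lemma alternating_sum_det:
  fixes ws :: "'e::euclidean_space list"
  assumes bs: "distinct bs" "set bs = (Basis :: 'e set)" and lam: "linear lam"
    and len: "length ws = Suc DIM('e)"
  shows "(\<Sum>j<length ws. (-1) ^ j * lam (ws ! j) *
      Determinant.det (Matrix.mat DIM('e) DIM('e)
        (\<lambda>(i, k). inner ((take j ws @ drop (Suc j) ws) ! i) (bs ! k)))) = (0::real)"
proof -
  let ?n = "DIM('e)"
  let ?B = "Matrix.mat (Suc ?n) (Suc ?n)
      (\<lambda>(i, k). case k of 0 \<Rightarrow> lam (ws ! i) | Suc k \<Rightarrow> inner (ws ! i) (bs ! k))"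
  \<comment> \<open>The coefficients of this linear dependence; the leading 1 makes the vector
    nonzero.\<close>
  let ?v = "Matrix.vec (Suc ?n) (\<lambda>k. case k of 0 \<Rightarrow> 1 | Suc k \<Rightarrow> - lam (bs ! k))"
  have "?B *\<^sub>v ?v = 0\<^sub>v (Suc ?n)"
  proof (rule eq_vecI)
    fix i assume i: "i < dim_vec (0\<^sub>v (Suc ?n) :: real Matrix.vec)"
    have "(?B *\<^sub>v ?v) $ i = lam (ws ! i) - (\<Sum>k<?n. inner (ws ! i) (bs ! k) * lam (bs ! k))"
      using i by (simp add: scalar_prod_def atLeast0LessThan sum.lessThan_Suc_shift sum_negf
          del: sum.op_ivl_Suc sum.lessThan_Suc)
    also have "\<dots> = 0"
      using linear_expand[OF lam, of "ws ! i"] by (simp add: sum_Basis_nth[OF bs])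
    finally show "(?B *\<^sub>v ?v) $ i = 0\<^sub>v (Suc ?n) $ i" using i by simp
  qed auto
  moreover have "?v \<noteq> 0\<^sub>v (Suc ?n)"
  proof
    assume "?v = 0\<^sub>v (Suc ?n)"
    then have "?v $ 0 = (0\<^sub>v (Suc ?n) :: real Matrix.vec) $ 0" by simp
    then show False by simp
  qed
  ultimately have det0: "Determinant.det ?B = 0"
    by (subst det_0_iff_vec_prod_zero[of _ "Suc ?n"]) (auto intro!: exI[of _ ?v])
  have laplace: "Determinant.det ?B = (\<Sum>i<Suc ?n. ?B $$ (i, 0) * cofactor ?B i 0)"
    by (rule laplace_expansion_column) auto
  have pt: "?B $$ (i, 0) * cofactor ?B i 0 = (-1) ^ i * lam (ws ! i) *
      Determinant.det (Matrix.mat ?n ?n (\<lambda>(j, k). inner ((take i ws @ drop (Suc i) ws) ! j) (bs ! k)))"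
    if i: "i < Suc ?n" for i
  proof -
    have "mat_delete ?B i 0 = Matrix.mat ?n ?n (\<lambda>(j, k). inner ((take i ws @ drop (Suc i) ws) ! j) (bs ! k))"
      using i len by (intro eq_matI) (auto simp: mat_delete_def nth_append min_def)
    then show ?thesis using i by (simp add: cofactor_def)
  qed
  have "(\<Sum>i<Suc ?n. (-1) ^ i * lam (ws ! i) *
      Determinant.det (Matrix.mat ?n ?n (\<lambda>(j, k). inner ((take i ws @ drop (Suc i) ws) ! j) (bs ! k)))) =
      (\<Sum>i<Suc ?n. ?B $$ (i, 0) * cofactor ?B i 0)"
    by (intro sum.cong refl pt[symmetric]) simp
  then show ?thesis unfolding len using trans[OF laplace[symmetric] det0] by (rule trans)
qed

lemma sum_lists_length_2:
  "(\<Sum>as\<in>{as. set as \<subseteq> A \<and> length as = 2}. f as) = (\<Sum>a\<in>A. \<Sum>b\<in>A. f [a, b])"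
proof -
  have "{as. set as \<subseteq> A \<and> length as = 2} = (\<lambda>(a, b). [a, b]) ` (A \<times> A)"
    by (auto simp: length_Suc_conv numeral_2_eq_2 image_iff)
  then have "(\<Sum>as\<in>{as. set as \<subseteq> A \<and> length as = 2}. f as) = (\<Sum>(a, b)\<in>A \<times> A. f [a, b])"
    by (simp add: sum.reindex inj_on_def case_prod_unfold prod_eq_iff)
  then show ?thesis by (simp add: sum.cartesian_product)
qed

section \<open>Co-closed 2-forms\<close>

text \<open>In a chart, the star contracts the bivector density \<open>sqrt |det h|\<close> times
  \<beta> with raised indices into a constant volume form. Its exterior derivative therefore
  contains only derivatives of this density, and alternation collapses them to the
  divergence.\<close>

lemma coclosed_of_divergence_free:
  fixes N :: "('a, 'i, 'e::euclidean_space) manifold"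
  assumes charts: "\<And>i. i \<in> ind N \<Longrightarrow> proper_chart N i" and dim: "DIM('e) \<ge> 2"
    and anti: "\<And>i q u v. i \<in> ind N \<Longrightarrow> q \<in> cdom N i \<Longrightarrow> \<beta> i q [v, u] = - \<beta> i q [u, v]"
    and F: "\<And>bs i p. distinct bs \<Longrightarrow> set bs = (Basis :: 'e set) \<Longrightarrow> i \<in> ind N \<Longrightarrow> p \<in> cdom N i \<Longrightarrow>
      \<exists>F'. (\<forall>k<DIM('e). \<forall>l<DIM('e). has_cderiv N i
          (\<lambda>q. sqrt \<bar>Determinant.det (Matrix.mat DIM('e) DIM('e) (\<lambda>(k, l). h i q (bs ! k) (bs ! l)))\<bar> *
            \<beta> i q [dual_vec (h i q) (bs ! k), dual_vec (h i q) (bs ! l)]) p (F' k l)) \<and>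
        (\<forall>l<DIM('e). (\<Sum>k<DIM('e). F' k l (bs ! k)) = 0)"
  shows "coclosed N h 2 \<beta>"
  unfolding coclosed_def closed_form_def
proof safe
  fix bs i p vs
  assume bs: "distinct bs" "set bs = (Basis :: 'e set)" and i: "i \<in> ind N" and p: "p \<in> cdom N i"
    and len: "length (vs :: 'e list) = Suc (DIM('e) - 2)"
  let ?n = "DIM('e)"
  define F where "F = (\<lambda>k l q. sqrt \<bar>Determinant.det (Matrix.mat ?n ?n (\<lambda>(k, l). h i q (bs ! k) (bs ! l)))\<bar> *
      \<beta> i q [dual_vec (h i q) (bs ! k), dual_vec (h i q) (bs ! l)])"
  define D where "D = (\<lambda>ws. Determinant.det (Matrix.mat ?n ?n (\<lambda>(i, k). inner ((ws :: 'e list) ! i) (bs ! k))))"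
  obtain F' where F': "\<And>k l. k < ?n \<Longrightarrow> l < ?n \<Longrightarrow> has_cderiv N i (F k l) p (F' k l)"
    and div: "\<And>l. l < ?n \<Longrightarrow> (\<Sum>k<?n. F' k l (bs ! k)) = 0"
    using F[OF bs i p] unfolding F_def by blast
  have skew: "F' l k v = - F' k l v" if "k < ?n" "l < ?n" for k l v
  proof -
    have neg: "has_cderiv N i (\<lambda>q. - F k l q) p (\<lambda>v. - F' k l v)"
      by (rule has_cderiv_bounded_linear[OF bounded_linear_minus[OF bounded_linear_ident] F'[OF that]])
    have "- F k l q = F l k q" if "q \<in> cdom N i" for q
    proof -
      have "\<beta> i q [dual_vec (h i q) (bs ! l), dual_vec (h i q) (bs ! k)] =
          - \<beta> i q [dual_vec (h i q) (bs ! k), dual_vec (h i q) (bs ! l)]"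
        by (rule anti[OF i that])
      then show ?thesis by (simp only: F_def mult_minus_right)
    qed
    then have "has_cderiv N i (F l k) p (\<lambda>v. - F' k l v)"
      by (rule has_cderiv_cong[OF charts[OF i] p _ neg])
    with F'[OF that(2,1)] show ?thesis by (metis cderiv_eq)
  qed
  have star: "hodge_star bs h 2 \<beta> i q ws = (\<Sum>k<?n. \<Sum>l<?n. F k l q * (D (bs ! k # bs ! l # ws) / 2))" for q ws
    unfolding hodge_star_def sum_lists_length_2 sum_Basis_nth[OF bs] vol_form_def F_def D_def
    by (simp add: fact_2 sum_divide_distrib mult_ac)
  let ?del = "\<lambda>j. take j vs @ drop (Suc j) vs"
  have star_deriv: "has_cderiv N i (\<lambda>q. hodge_star bs h 2 \<beta> i q ws) p
      (\<lambda>v. \<Sum>k<?n. \<Sum>l<?n. F' k l v * (D (bs ! k # bs ! l # ws) / 2))" for ws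
    unfolding star
    by (intro has_cderiv_sum has_cderiv_bounded_linear[OF bounded_linear_mult_left] F') auto
  have "ext_deriv N (hodge_star bs h 2 \<beta>) i p vs =
      (\<Sum>j<length vs. (-1) ^ j * (\<Sum>k<?n. \<Sum>l<?n. F' k l (vs ! j) * (D (bs ! k # bs ! l # ?del j) / 2)))"
    unfolding ext_deriv_def by (simp add: cderiv_eq[OF star_deriv])
  also have "\<dots> = (\<Sum>j<length vs. \<Sum>k<?n. \<Sum>l<?n. (-1) ^ j * F' k l (vs ! j) * D (bs ! k # bs ! l # ?del j) / 2)"
    by (simp add: sum_distrib_left mult_ac)
  also have "\<dots> = (\<Sum>k<?n. \<Sum>j<length vs. \<Sum>l<?n. (-1) ^ j * F' k l (vs ! j) * D (bs ! k # bs ! l # ?del j) / 2)"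
    by (rule sum.swap)
  also have "\<dots> = (\<Sum>k<?n. \<Sum>l<?n. \<Sum>j<length vs. (-1) ^ j * F' k l (vs ! j) * D (bs ! k # bs ! l # ?del j) / 2)"
    by (intro sum.cong refl sum.swap)
  also have "\<dots> = (\<Sum>k<?n. \<Sum>l<?n. F' k l (bs ! l) * D (bs ! k # vs) / 2 - F' k l (bs ! k) * D (bs ! l # vs) / 2)"
  proof (intro sum.cong refl)
    fix k l assume kl: "k \<in> {..<?n}" "l \<in> {..<?n}"
    \<comment> \<open>The list has one vector more than the dimension; \<open>dim\<close> is what
      makes the truncated subtraction in \<open>len\<close> exact here. The first two terms of the
      vanishing alternating sum trade derivatives along \<open>vs\<close> for derivatives along the
      two contracted basis vectors.\<close>
    let ?ws = "bs ! k # bs ! l # vs"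
    have "(\<Sum>j<length ?ws. (-1) ^ j * F' k l (?ws ! j) * D (take j ?ws @ drop (Suc j) ?ws)) = 0"
      unfolding D_def using has_cderiv_linear[OF F'] kl len dim
      by (intro alternating_sum_det bs) auto
    then have "F' k l (bs ! k) * D (bs ! l # vs) - F' k l (bs ! l) * D (bs ! k # vs) +
        (\<Sum>j<length vs. (-1) ^ j * F' k l (vs ! j) * D (bs ! k # bs ! l # ?del j)) = 0"
      by (simp add: sum.lessThan_Suc_shift del: sum.lessThan_Suc)
    then show "(\<Sum>j<length vs. (-1) ^ j * F' k l (vs ! j) * D (bs ! k # bs ! l # ?del j) / 2) =
        F' k l (bs ! l) * D (bs ! k # vs) / 2 - F' k l (bs ! k) * D (bs ! l # vs) / 2"
      by (simp flip: sum_divide_distrib diff_divide_distrib)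
  qed
  also have "\<dots> = (\<Sum>k<?n. \<Sum>l<?n. F' k l (bs ! l) * D (bs ! k # vs) / 2) -
      (\<Sum>k<?n. \<Sum>l<?n. F' k l (bs ! k) * D (bs ! l # vs) / 2)"
    by (simp add: sum_subtractf)
  also have "(\<Sum>k<?n. \<Sum>l<?n. F' k l (bs ! k) * D (bs ! l # vs) / 2) =
      (\<Sum>l<?n. (\<Sum>k<?n. F' k l (bs ! k)) * (D (bs ! l # vs) / 2))"
    by (subst sum.swap) (simp add: sum_distrib_right sum_divide_distrib)
  also have "\<dots> = 0" by (simp add: div)
  also have "(\<Sum>k<?n. \<Sum>l<?n. F' k l (bs ! l) * D (bs ! k # vs) / 2) =
      (\<Sum>k<?n. - (\<Sum>l<?n. F' l k (bs ! l)) * (D (bs ! k # vs) / 2))"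
    unfolding sum_negf[symmetric] sum_distrib_right
  proof (intro sum.cong refl)
    fix k l assume "k \<in> {..<?n}" "l \<in> {..<?n}"
    then have "F' k l (bs ! l) = - F' l k (bs ! l)" by (intro skew) auto
    then show "F' k l (bs ! l) * D (bs ! k # vs) / 2 = - F' l k (bs ! l) * (D (bs ! k # vs) / 2)"
      by simp
  qed
  also have "\<dots> = 0" by (simp add: div)
  finally show "ext_deriv N (hodge_star bs h 2 \<beta>) i p vs = 0" by simp
qed

text \<open>Nondegeneracy makes the map from \<open>u\<close> to \<open>b u\<close> injective, hence
  bijective in finite dimension, so that the \<open>THE\<close> in \<open>dual_vec\<close> denotes a
  vector. The defining equations on \<open>Basis\<close> then extend linearly to all
  \<open>v\<close>.\<close>

lemma dual_vec:
  fixes e :: "'e::euclidean_space"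
  assumes b: "bilinear b" and nondeg: "\<And>u. (\<And>v. b u v = 0) \<Longrightarrow> u = 0" and e: "e \<in> Basis"
  shows "b (dual_vec b e) v = inner v e"
proof -
  define f where "f = (\<lambda>w. \<Sum>c\<in>Basis. b w c *\<^sub>R c)"
  have f: "inner (f w) c = b w c" if "c \<in> Basis" for w c
    using that by (simp add: f_def inner_sum_left inner_Basis if_distrib cong: if_cong)
  have lin: "linear (b w)" for w using b by (simp add: bilinear_def)
  have "linear f"
    unfolding f_def
    by (intro linearI) (simp_all add: bilinear_ladd[OF b] bilinear_lmul[OF b] scaleR_add_left sum.distrib scaleR_sum_right)
  moreover have "inj f"
  proof (subst linear_injective_0[OF \<open>linear f\<close>], safe)
    fix u assume "f u = 0"
    then have "b u c = 0" if "c \<in> Basis" for c using f[OF that, of u] by simp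
    then have "b u v = 0" for v using linear_expand[OF lin, of u v] by simp
    then show "u = 0" by (rule nondeg)
  qed
  ultimately have "surj f" by (rule linear_inj_imp_surj)
  then obtain w where w: "f w = e" by (metis surjD)
  have "dual_vec b e = w"
    unfolding dual_vec_def
  proof (rule the_equality)
    show "\<forall>c\<in>Basis. b w c = (if c = e then 1 else 0)"
    proof
      fix c :: 'e assume c: "c \<in> Basis"
      have "b w c = inner e c" using f[OF c, of w] w by simp
      then show "b w c = (if c = e then 1 else 0)" using c e by (auto simp: inner_Basis)
    qed
    fix y assume "\<forall>c\<in>Basis. b y c = (if c = e then 1 else 0)"
    then have "inner (f y) c = inner e c" if "c \<in> Basis" for c
      unfolding f[OF that] inner_Basis[OF e that] using that by (metis (full_types))
    then have "f y = e" by (rule euclidean_eqI)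
    with w \<open>inj f\<close> show "y = w" by (metis injD)
  qed
  moreover have "b w v = inner v e"
  proof -
    have "b w c = inner e c" if "c \<in> Basis" for c
      using f[OF that, of w] w by simp
    then have "b w v = (\<Sum>c\<in>Basis. inner v c * inner e c)"
      using linear_expand[OF lin, of w v] by simp
    then show ?thesis by (simp flip: euclidean_inner)
  qed
  ultimately show ?thesis by simp
qed

text \<open>A real matrix whose fourth power is the identity has determinant 1 or -1. The order is 4
  because the endomorphism used later squares to the identity on the torus directions and to minus
  the identity along \<open>M\<close>.\<close>

lemma abs_det_compose_order_4:
  fixes L :: "'e::euclidean_space \<Rightarrow> 'e" and b :: "'e \<Rightarrow> 'e \<Rightarrow> real"
  assumes bs: "distinct bs" "set bs = (Basis :: 'e set)" and b: "bilinear b" and L: "linear L"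
    and L4: "\<And>u. L (L (L (L u))) = u"
  shows "\<bar>Determinant.det (Matrix.mat DIM('e) DIM('e) (\<lambda>(i, j). b (bs ! i) (L (bs ! j))))\<bar> =
    \<bar>Determinant.det (Matrix.mat DIM('e) DIM('e) (\<lambda>(i, j). b (bs ! i) (bs ! j)))\<bar>"
proof -
  let ?n = "DIM('e)"
  let ?m = "\<lambda>A. Matrix.mat ?n ?n (\<lambda>(i, j). inner (A (bs ! j)) (bs ! i))"
  let ?H = "\<lambda>A. Matrix.mat ?n ?n (\<lambda>(i, j). b (bs ! i) (A (bs ! j)))"
  have len: "length bs = ?n" using bs distinct_card by force
  have H: "?H L = ?H (\<lambda>x. x) * ?m L"
  proof (rule eq_matI)
    fix i j assume "i < dim_row (?H (\<lambda>x. x) * ?m L)" "j < dim_col (?H (\<lambda>x. x) * ?m L)"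
    moreover have "linear (b u)" for u using b by (simp add: bilinear_def)
    ultimately show "?H L $$ (i, j) = (?H (\<lambda>x. x) * ?m L) $$ (i, j)"
      using linear_expand[of "b (bs ! i)" "L (bs ! j)"]
      by (simp add: scalar_prod_def atLeast0LessThan sum_Basis_nth[OF bs] mult.commute)
  qed auto
  have m: "?m A * ?m B = ?m (\<lambda>x. A (B x))" if "linear A" for A B
  proof (rule eq_matI)
    fix i j assume "i < dim_row (?m (\<lambda>x. A (B x)))" "j < dim_col (?m (\<lambda>x. A (B x)))"
    then show "(?m A * ?m B) $$ (i, j) = ?m (\<lambda>x. A (B x)) $$ (i, j)"
      using linear_expand[OF that, of "B (bs ! j)"]
      by (simp add: scalar_prod_def atLeast0LessThan inner_sum_left sum_Basis_nth[OF bs] mult.commute)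
  qed auto
  have "?m L * (?m L * (?m L * ?m L)) = ?m (\<lambda>x. x)"
    using m[OF L, of L] m[OF L, of "\<lambda>x. L (L x)"] m[OF L, of "\<lambda>x. L (L (L x))"] by (simp add: L4)
  also have "\<dots> = 1\<^sub>m ?n"
    using bs len by (intro eq_matI) (auto simp: inner_Basis nth_eq_iff_index_eq nth_mem[of _ bs, simplified bs(2)])
  finally have "Determinant.det (?m L * (?m L * (?m L * ?m L))) = 1" by simp
  then have "Determinant.det (?m L) ^ 4 = 1"
    by (simp add: det_mult[of _ ?n] mult_carrier_mat[of _ ?n ?n] power4_eq_xxxx mult_ac)
  then have "\<bar>Determinant.det (?m L)\<bar> = 1"
    using power_eq_imp_eq_base[of "\<bar>Determinant.det (?m L)\<bar>" 4 1] by (simp flip: power_abs)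
  then show ?thesis
    unfolding H by (simp add: det_mult[of _ ?n] abs_mult)
qed

text \<open>The codifferential of \<open>\<beta>\<close> is the divergence of the bivector obtained by raising its indices
  with \<open>h\<close>. By \<open>\<beta>(u, L v) = -h(u, v)\<close>, this bivector is minus the inverse of the closed 2-form
  \<open>h(\<cdot>, L \<cdot>)\<close>, whose determinant is \<open>\<plusminus>det h\<close> because \<open>L\<^sup>4 = 1\<close>.\<close>

lemma coclosed_of_closed_inverse:
  fixes N :: "('a, 'i, 'e::euclidean_space) manifold" and h :: "('a, 'i, 'e) tensor2" and L :: "('a, 'i, 'e) endo"
  assumes charts: "\<And>i. i \<in> ind N \<Longrightarrow> proper_chart N i" and dim: "DIM('e) \<ge> 2"
    and h: "\<And>i q. i \<in> ind N \<Longrightarrow> q \<in> cdom N i \<Longrightarrow> bilinear (h i q)"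
      "\<And>i q u v. i \<in> ind N \<Longrightarrow> q \<in> cdom N i \<Longrightarrow> h i q u v = h i q v u"
      "\<And>i q u. i \<in> ind N \<Longrightarrow> q \<in> cdom N i \<Longrightarrow> (\<And>v. h i q u v = 0) \<Longrightarrow> u = 0"
    and L: "\<And>i q. i \<in> ind N \<Longrightarrow> q \<in> cdom N i \<Longrightarrow> linear (L i q)"
      "\<And>i q u. i \<in> ind N \<Longrightarrow> q \<in> cdom N i \<Longrightarrow> L i q (L i q (L i q (L i q u))) = u"
    and \<beta>: "\<And>i q. i \<in> ind N \<Longrightarrow> q \<in> cdom N i \<Longrightarrow> bilinear (\<lambda>u v. \<beta> i q [u, v])"
      "\<And>i q u v. i \<in> ind N \<Longrightarrow> q \<in> cdom N i \<Longrightarrow> \<beta> i q [v, u] = - \<beta> i q [u, v]"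
      "\<And>i q u v. i \<in> ind N \<Longrightarrow> q \<in> cdom N i \<Longrightarrow> \<beta> i q [u, L i q v] = - h i q u v"
    and W: "\<And>i q u v. i \<in> ind N \<Longrightarrow> q \<in> cdom N i \<Longrightarrow> h i q v (L i q u) = - h i q u (L i q v)"
      "\<And>i p u v. i \<in> ind N \<Longrightarrow> p \<in> cdom N i \<Longrightarrow> has_cderiv N i (\<lambda>q. h i q u (L i q v)) p (W' i p u v)"
      "\<And>i p u v w. i \<in> ind N \<Longrightarrow> p \<in> cdom N i \<Longrightarrow> W' i p u v w + W' i p v w u + W' i p w u v = 0"
  shows "coclosed N h 2 \<beta>"
proof (rule coclosed_of_divergence_free[where N = N and h = h and \<beta> = \<beta>, OF charts dim \<beta>(2)])
  fix bs i p
  assume bs: "distinct bs" "set bs = (Basis :: 'e set)" and i: "i \<in> ind N" and p: "p \<in> cdom N i"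
  let ?n = "DIM('e)"
  let ?P = "param N i" and ?S = "crd N i ` cdom N i"
  let ?d = "\<lambda>q k. dual_vec (h i q) (bs ! k)"
  define w where "w = (\<lambda>x k l. h i (?P x) (bs ! k) (L i (?P x) (bs ! l)))"
  define r where "r = (\<lambda>x k l. - \<beta> i (?P x) [?d (?P x) k, ?d (?P x) l])"
  have len: "length bs = ?n" using bs distinct_card by force
  then have nth: "bs ! k \<in> Basis" if "k < ?n" for k using that bs nth_mem by metis
  have dual: "h i q (?d q k) v = inner v (bs ! k)" if "q \<in> cdom N i" "k < ?n" for q k v
    by (rule dual_vec[OF h(1)[OF i that(1)] h(3)[OF i that(1)] nth[OF that(2)]])
  have S: "open ?S" using charts[OF i] by (simp add: proper_chart_def)
  \<comment> \<open>By bilinearity the sum becomes \<beta> of a dual vector and the dual-basis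
    expansion of \<open>L\<close> applied to a basis vector. The relation between \<beta>,
    \<open>L\<close> and \<open>h\<close>, followed by duality, evaluates this to the Kronecker
    delta.\<close>
  have inv: "(\<Sum>l<?n. w x k l * r x l m) = (if k = m then 1 else 0)" if x: "x \<in> ?S" and km: "k < ?n" "m < ?n" for x k m
  proof -
    define q where "q = ?P x"
    have q: "q \<in> cdom N i" using x by (simp add: q_def param_in_cdom)
    have "(\<Sum>l<?n. w x k l * r x l m) = - (\<Sum>l<?n. h i q (bs ! l) (L i q (bs ! k)) * \<beta> i q [?d q m, ?d q l])"
      unfolding w_def r_def q_def[symmetric] sum_negf[symmetric]
      by (rule sum.cong[OF refl]) (simp add: W(1)[OF i q, of "bs ! k"] \<beta>(2)[OF i q, of _ "?d q m"])
    also have "(\<Sum>l<?n. h i q (bs ! l) (L i q (bs ! k)) * \<beta> i q [?d q m, ?d q l]) =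
        \<beta> i q [?d q m, \<Sum>l<?n. h i q (bs ! l) (L i q (bs ! k)) *\<^sub>R ?d q l]"
    proof -
      have lin: "linear (\<lambda>v. \<beta> i q [?d q m, v])" using \<beta>(1)[OF i q] by (simp add: bilinear_def)
      show ?thesis by (simp add: linear_sum[OF lin] linear_scale[OF lin])
    qed
    \<comment> \<open>Lowering an index and raising it again changes nothing: both sides have the
      same \<open>h\<close>-product with every vector.\<close>
    also have "(\<Sum>l<?n. h i q (bs ! l) (L i q (bs ! k)) *\<^sub>R ?d q l) = L i q (bs ! k)" (is "?y = _")
    proof -
      have "h i q (?y - L i q (bs ! k)) v = 0" for v
      proof -
        have lin: "linear (\<lambda>u. h i q u v)" "linear (\<lambda>u. h i q u (L i q (bs ! k)))"
          using h(1)[OF i q] by (simp_all add: bilinear_def)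
        have "h i q ?y v = (\<Sum>l<?n. h i q (bs ! l) (L i q (bs ! k)) * inner v (bs ! l))"
          by (simp add: linear_sum[OF lin(1)] linear_scale[OF lin(1)] dual[OF q])
        also have "\<dots> = h i q v (L i q (bs ! k))"
          using linear_expand[OF lin(2), of v] by (simp add: sum_Basis_nth[OF bs] mult.commute)
        finally show ?thesis
          using linear_diff[OF lin(1)] h(2)[OF i q, of v] by simp
      qed
      then have "?y - L i q (bs ! k) = 0" by (rule h(3)[OF i q])
      then show ?thesis by simp
    qed
    also have "- \<beta> i q [?d q m, L i q (bs ! k)] = (if k = m then 1 else 0)"
      using km nth bs len by (simp add: \<beta>(3)[OF i q] dual[OF q] inner_Basis nth_eq_iff_index_eq)
    finally show ?thesis .
  qed
  obtain G where G: "\<And>k l. k < ?n \<Longrightarrow> l < ?n \<Longrightarrow>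
      ((\<lambda>y. sqrt \<bar>Determinant.det (Matrix.mat ?n ?n (\<lambda>(k, l). w y k l))\<bar> * r y k l) has_derivative G k l) (at (crd N i p))"
    and div: "\<And>l. l < ?n \<Longrightarrow> (\<Sum>k<?n. G k l (bs ! k)) = 0"
  proof (rule sqrt_det_inverse_divergence_free[of ?n w "\<lambda>k l. W' i p (bs ! k) (bs ! l)" "crd N i p" ?S r "(!) bs"])
    show "((\<lambda>x. w x k l) has_derivative W' i p (bs ! k) (bs ! l)) (at (crd N i p))" for k l
      using W(2)[OF i p] by (simp add: w_def has_cderiv_def)
    show "crd N i p \<in> ?S" using p by simp
    show "w y l k = - w y k l" if "y \<in> ?S" for y k l
      unfolding w_def by (rule W(1)[OF i param_in_cdom[OF that]])
    show "r (crd N i p) l k = - r (crd N i p) k l" for k l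
    proof -
      have "\<beta> i p [?d p l, ?d p k] = - \<beta> i p [?d p k, ?d p l]" by (rule \<beta>(2)[OF i p])
      then show ?thesis by (simp only: r_def param_crd[OF charts[OF i] p])
    qed
    show "W' i p (bs ! k) (bs ! l) (bs ! m) + W' i p (bs ! l) (bs ! m) (bs ! k) + W' i p (bs ! m) (bs ! k) (bs ! l) = 0" for k l m
      by (rule W(3)[OF i p])
  qed (use S inv in blast)+
  let ?F = "\<lambda>k l q. sqrt \<bar>Determinant.det (Matrix.mat ?n ?n (\<lambda>(k, l). h i q (bs ! k) (bs ! l)))\<bar> * \<beta> i q [?d q k, ?d q l]"
  have "has_cderiv N i (?F k l) p (\<lambda>v. - G k l v)" if kl: "k < ?n" "l < ?n" for k l
  proof -
    have "((\<lambda>y. - (sqrt \<bar>Determinant.det (Matrix.mat ?n ?n (\<lambda>(k, l). w y k l))\<bar> * r y k l)) has_derivative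
        (\<lambda>v. - G k l v)) (at (crd N i p))"
      by (rule has_derivative_minus[OF G[OF kl]])
    then show ?thesis
      unfolding has_cderiv_def
    proof (rule has_derivative_transform_within_open[OF _ S])
      show "crd N i p \<in> ?S" using p by simp
      \<comment> \<open>The determinant lemma replaces the density of \<open>w\<close> by that of
        \<open>h\<close>; the minus sign undoes the one in \<open>r\<close>.\<close>
      show "- (sqrt \<bar>Determinant.det (Matrix.mat ?n ?n (\<lambda>(k, l). w x k l))\<bar> * r x k l) = ?F k l (?P x)" if "x \<in> ?S" for x
        using abs_det_compose_order_4[OF bs h(1)[OF i param_in_cdom[OF that]] L[OF i param_in_cdom[OF that]]]
        by (simp add: w_def r_def)
    qed
  qed
  moreover have "(\<Sum>k<?n. - G k l (bs ! k)) = 0" if "l < ?n" for l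
    using div[OF that] by (simp add: sum_negf)
  ultimately show "\<exists>F'. (\<forall>k<?n. \<forall>l<?n. has_cderiv N i (?F k l) p (F' k l)) \<and> (\<forall>l<?n. (\<Sum>k<?n. F' k l (bs ! k)) = 0)"
    by (intro exI[of _ "\<lambda>k l v. - G k l v"]) blast
qed

section \<open>The metric on the product\<close>

lemma cis_in_circle_chart: "cis t \<in> cdom circle (t - pi)"
  by auto

locale almost_kaehler_pp =
  fixes M :: "('a, 'i, 'e::euclidean_space) manifold"
    and gR :: "('a, 'i, 'e) tensor2"
    and JR :: "('a, 'i, 'e) endo"
    and H :: "complex \<times> 'a \<Rightarrow> real"
  assumes M: "smooth_manifold M"
    and almost_kaehler_M: "almost_kaehler M gR JR"
    and H: "smooth_function (circle \<times>\<^sub>M M) H"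
begin

abbreviation "N \<equiv> circle \<times>\<^sub>M circle \<times>\<^sub>M M"
abbreviation "h \<equiv> pp_metric gR H"
abbreviation "g \<equiv> dual_metric (pp_metric gR H) (T_field H)"
abbreviation "J \<equiv> pp_J gR JR H"

lemma proper_chart_M: "k \<in> ind M \<Longrightarrow> proper_chart M k"
  by (rule smooth_manifold_proper_chart[OF M])

lemma proper_chart_circle_M: "k \<in> ind M \<Longrightarrow> proper_chart (circle \<times>\<^sub>M M) (b, k)"
  by (intro proper_chart_prod proper_chart_circle proper_chart_M)

lemma proper_chart_N: "k \<in> ind M \<Longrightarrow> proper_chart N (a, b, k)"
  by (intro proper_chart_prod proper_chart_circle proper_chart_M)

section \<open>Algebra and closedness of the fundamental form on \<open>M\<close>\<close>

lemma metric_M: "riemannian_metric M gR" and acs_M: "almost_complex M JR"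
  and compatible_M: "compatible M gR JR" and closed_M: "closed_form M 2 (fundamental_form gR JR)"
  using almost_kaehler_M by (auto simp: almost_kaehler_def)

lemma gR_bilinear: "k \<in> ind M \<Longrightarrow> m \<in> cdom M k \<Longrightarrow> bilinear (gR k m)"
  and gR_sym: "k \<in> ind M \<Longrightarrow> m \<in> cdom M k \<Longrightarrow> gR k m u v = gR k m v u"
  and gR_pos: "k \<in> ind M \<Longrightarrow> m \<in> cdom M k \<Longrightarrow> u \<noteq> 0 \<Longrightarrow> gR k m u u > 0"
  and gR_smooth: "k \<in> ind M \<Longrightarrow> smooth_in_chart M k (\<lambda>p. gR k p u v)"
  using metric_M by (auto simp: riemannian_metric_def)

lemma JR_linear: "k \<in> ind M \<Longrightarrow> m \<in> cdom M k \<Longrightarrow> linear (JR k m)"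
  and JR_JR: "k \<in> ind M \<Longrightarrow> m \<in> cdom M k \<Longrightarrow> JR k m (JR k m u) = - u"
  and JR_smooth: "k \<in> ind M \<Longrightarrow> smooth_in_chart M k (\<lambda>p. JR k p u)"
  using acs_M by (auto simp: almost_complex_def)

lemma gR_JR: "k \<in> ind M \<Longrightarrow> m \<in> cdom M k \<Longrightarrow> gR k m (JR k m u) (JR k m v) = gR k m u v"
  using compatible_M by (auto simp: compatible_def)

lemma gR_JR_skew:
  assumes "k \<in> ind M" "m \<in> cdom M k"
  shows "gR k m v (JR k m u) = - gR k m u (JR k m v)"
proof -
  have "gR k m v (JR k m u) = gR k m (JR k m v) (- u)"
    using gR_JR[OF assms, of v "JR k m u"] JR_JR[OF assms] by simp
  also have "\<dots> = - gR k m u (JR k m v)"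
    using bilinear_rneg[OF gR_bilinear[OF assms]] gR_sym[OF assms, of "JR k m v" u] by simp
  finally show ?thesis .
qed

lemma omega_R_smooth:
  assumes k: "k \<in> ind M"
  shows "smooth_in_chart M k (\<lambda>m. gR k m u (JR k m v))"
proof -
  have "smooth_in_chart M k (\<lambda>m. \<Sum>c\<in>Basis. inner (JR k m v) c * gR k m u c)"
    by (intro smooth_in_chart_sum smooth_in_chart_mult smooth_in_chart_bounded_linear[OF _ bounded_linear_inner_left]
        proper_chart_M JR_smooth gR_smooth k)
  moreover have "gR k m u (JR k m v) = (\<Sum>c\<in>Basis. inner (JR k m v) c * gR k m u c)" if "m \<in> cdom M k" for m
    using linear_expand[of "gR k m u" "JR k m v"] gR_bilinear[OF k that] by (simp add: bilinear_def)
  ultimately show ?thesis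
    using smooth_in_chart_cong[OF proper_chart_M[OF k]] by (metis (no_types, lifting))
qed

text \<open>Not the exterior derivative, despite the name: a component function is differentiated in
  the direction of the last argument. The exterior derivative is the cyclic sum.\<close>

definition d_omega_R :: "'i \<Rightarrow> 'a \<Rightarrow> 'e \<Rightarrow> 'e \<Rightarrow> 'e \<Rightarrow> real" where
  "d_omega_R k m u v = cderiv M k (\<lambda>m. gR k m u (JR k m v)) m"

lemma omega_R_has_cderiv:
  "k \<in> ind M \<Longrightarrow> m \<in> cdom M k \<Longrightarrow> has_cderiv M k (\<lambda>m. gR k m u (JR k m v)) m (d_omega_R k m u v)"
  unfolding d_omega_R_def by (intro smooth_in_chart_has_cderiv proper_chart_M omega_R_smooth)

lemma d_omega_R_skew:
  assumes "k \<in> ind M" "m \<in> cdom M k"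
  shows "d_omega_R k m v u w = - d_omega_R k m u v w"
proof -
  have "has_cderiv M k (\<lambda>m. - gR k m u (JR k m v)) m (\<lambda>w. - d_omega_R k m u v w)"
    by (rule has_cderiv_bounded_linear[OF bounded_linear_minus[OF bounded_linear_ident] omega_R_has_cderiv[OF assms]])
  then have "has_cderiv M k (\<lambda>m. gR k m v (JR k m u)) m (\<lambda>w. - d_omega_R k m u v w)"
    by (rule has_cderiv_cong[OF proper_chart_M[OF assms(1)] assms(2), rotated]) (rule gR_JR_skew[OF assms(1), symmetric])
  from cderiv_eq[OF this] show ?thesis by (simp add: d_omega_R_def)
qed

lemma d_omega_R_cyclic:
  assumes "k \<in> ind M" "m \<in> cdom M k"
  shows "d_omega_R k m u v w + d_omega_R k m v w u + d_omega_R k m w u v = 0"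
proof -
  have "ext_deriv M (fundamental_form gR JR) k m [w, u, v] = 0"
    using closed_M assms by (simp add: closed_form_def)
  then have "d_omega_R k m u v w - d_omega_R k m w v u + d_omega_R k m w u v = 0"
    by (simp add: ext_deriv_def fundamental_form_def d_omega_R_def lessThan_Suc numeral_2_eq_2)
  then show ?thesis using d_omega_R_skew[OF assms, of v w u] by simp
qed

text \<open>For \<open>X = (r, s, u)\<close> one has \<open>h(T, X) = - r + (1 - H) / 2 * s\<close>.
  Adding twice its square to \<open>h\<close> makes the torus block of \<open>g\<close> the matrix
  with rows \<open>(2, H)\<close> and \<open>(H, (H^2 + 1) / 2)\<close>.\<close>

lemma g_eq:
  assumes "k \<in> ind M" "m \<in> cdom M k"
  shows "g (a, b, k) (z, w, m) (r, s, u) (r', s', u') =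
    2 * r * r' + H (w, m) * (r * s' + s * r') + ((H (w, m))\<^sup>2 + 1) / 2 * (s * s') + gR k m u u'"
  using bilinear_lzero[OF gR_bilinear[OF assms]]
  by (simp add: dual_metric_def pp_metric_def T_field_def field_simps power2_eq_square)

text \<open>The torus block has trace 0 and determinant 1, so its square is minus the identity by
  Cayley-Hamilton.\<close>

lemma J_eq:
  assumes "k \<in> ind M" "m \<in> cdom M k"
  shows "J (a, b, k) (z, w, m) (r, s, u) =
    (H (w, m) * r + ((H (w, m))\<^sup>2 + 1) / 2 * s, - 2 * r - H (w, m) * s, JR k m u)"
  using bilinear_rzero[OF gR_bilinear[OF assms]]
  by (simp add: pp_J_def Let_def pp_metric_def T_field_def Z_field_def field_simps power2_eq_square)

lemma omega_eq:
  assumes "k \<in> ind M" "m \<in> cdom M k"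
  shows "g (a, b, k) (z, w, m) (r, s, u) (J (a, b, k) (z, w, m) (r', s', u')) =
    r * s' - s * r' + gR k m u (JR k m u')"
  unfolding g_eq[OF assms] J_eq[OF assms] by (simp add: field_simps power2_eq_square)

section \<open>Derivatives, smoothness and transition maps on \<open>N\<close>\<close>

lemma has_cderiv_M:
  assumes "k \<in> ind M" "z \<in> cdom circle a" "w \<in> cdom circle b" "m \<in> cdom M k" "has_cderiv M k f m D"
  shows "has_cderiv N (a, b, k) (\<lambda>p. f (snd (snd p))) (z, w, m) (\<lambda>v. D (snd (snd v)))"
proof -
  have "has_cderiv (circle \<times>\<^sub>M M) (b, k) (\<lambda>p. f (snd p)) (w, m) (\<lambda>v. D (snd v))"
    by (rule has_cderiv_snd[OF proper_chart_circle proper_chart_M]) (use assms in auto)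
  then show ?thesis
    by (intro has_cderiv_snd[OF proper_chart_circle proper_chart_circle_M]) (use assms in auto)
qed

lemma smooth_in_chart_M:
  assumes "k \<in> ind M" "smooth_in_chart M k f"
  shows "smooth_in_chart N (a, b, k) (\<lambda>p. f (snd (snd p)))"
  using smooth_in_chart_snd[OF proper_chart_circle proper_chart_circle_M[OF assms(1)]
      smooth_in_chart_snd[OF proper_chart_circle proper_chart_M[OF assms(1)] assms(2)]] .

lemma H_smooth: "k \<in> ind M \<Longrightarrow> smooth_in_chart (circle \<times>\<^sub>M M) (b, k) H"
  using H by (simp add: smooth_function_def)

lemma H_smooth_N: "k \<in> ind M \<Longrightarrow> smooth_in_chart N (a, b, k) (\<lambda>p. H (snd p))"
  by (intro smooth_in_chart_snd proper_chart_circle proper_chart_circle_M H_smooth)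

lemma transition_N:
  assumes "k \<in> ind M" "k' \<in> ind M" "z \<in> cdom circle a \<inter> cdom circle a'"
    "w \<in> cdom circle b \<inter> cdom circle b'" "m \<in> cdom M k \<inter> cdom M k'"
  shows "cderiv N (a, b, k) (crd N (a', b', k')) (z, w, m) (r, s, u) = (r, s, cderiv M k (crd M k') m u)"
proof -
  have "has_cderiv (circle \<times>\<^sub>M M) (b, k) (\<lambda>p. (crd circle b' (fst p), crd M k' (snd p))) (w, m)
      (\<lambda>v. (fst v, cderiv M k (crd M k') m (snd v)))"
    using assms by (intro has_cderiv_Pair has_cderiv_fst[OF proper_chart_circle proper_chart_M _ _ circle_transition]
        has_cderiv_snd[OF proper_chart_circle proper_chart_M] smooth_manifold_transition[OF M]) auto
  then have "has_cderiv N (a, b, k) (\<lambda>p. (crd circle a' (fst p), crd circle b' (fst (snd p)), crd M k' (snd (snd p)))) (z, w, m)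
      (\<lambda>v. (fst v, fst (snd v), cderiv M k (crd M k') m (snd (snd v))))"
    using assms by (intro has_cderiv_Pair[OF has_cderiv_fst[OF proper_chart_circle proper_chart_circle_M _ _ circle_transition]
        has_cderiv_snd[OF proper_chart_circle proper_chart_circle_M, where f = "\<lambda>p. (crd circle b' (fst p), crd M k' (snd p))" and
           D = "\<lambda>v. (fst v, cderiv M k (crd M k') m (snd v))"]]) auto
  moreover have "crd N (a', b', k') = (\<lambda>p. (crd circle a' (fst p), crd circle b' (fst (snd p)), crd M k' (snd (snd p))))"
    by (auto simp: fun_eq_iff)
  ultimately show ?thesis by (simp only: cderiv_eq) simp
qed

section \<open>The almost Kaehler structure on \<open>N\<close>\<close>

lemma riemannian_metric_N: "riemannian_metric N g"
  unfolding riemannian_metric_def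
proof (intro conjI ballI allI impI)
  fix c p assume "c \<in> ind N" "p \<in> cdom N c"
  then obtain a b k z w m where c: "c = (a, b, k)" "p = (z, w, m)" and km: "k \<in> ind M" "m \<in> cdom M k"
    by (cases c; cases p) auto
  show "bilinear (g c p)"
    unfolding bilinear_def c
    by (intro conjI allI linearI)
      (auto simp: g_eq[OF km] bilinear_radd[OF gR_bilinear[OF km]] bilinear_ladd[OF gR_bilinear[OF km]]
        bilinear_rmul[OF gR_bilinear[OF km]] bilinear_lmul[OF gR_bilinear[OF km]] field_simps)
  show "g c p u v = g c p v u" for u v
  proof -
    have "gR k m (snd (snd u)) (snd (snd v)) = gR k m (snd (snd v)) (snd (snd u))"
      by (rule gR_sym[OF km])
    then show ?thesis by (cases u; cases v) (simp add: c g_eq[OF km] algebra_simps)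
  qed
  fix v assume v: "v \<noteq> (0 :: real \<times> real \<times> 'e)"
  obtain r s u where v_eq: "v = (r, s, u)" by (cases v)
  \<comment> \<open>Completing the square in \<open>r\<close>; as the torus block has determinant 1,
    the remaining coefficient of \<open>s\<close> squared is 1/2.\<close>
  have "g c p v v = 2 * (r + H (w, m) * s / 2)\<^sup>2 + s\<^sup>2 / 2 + gR k m u u"
    unfolding c v_eq g_eq[OF km] by (simp add: field_simps power2_eq_square)
  also have "\<dots> > 0"
  proof (cases "u = 0")
    case True
    then have "gR k m u u = 0" using bilinear_lzero[OF gR_bilinear[OF km]] by simp
    moreover have "2 * (r + H (w, m) * s / 2)\<^sup>2 + s\<^sup>2 / 2 > 0"
    proof (cases "s = 0")
      case True
      then show ?thesis using v \<open>u = 0\<close> by (simp add: v_eq zero_prod_def)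
    next
      case False
      then have "s\<^sup>2 / 2 > 0" by simp
      then show ?thesis using zero_le_power2[of "r + H (w, m) * s / 2"] by linarith
    qed
    ultimately show ?thesis by simp
  next
    case False
    then show ?thesis using gR_pos[OF km False] by (simp add: add_nonneg_pos)
  qed
  finally show "g c p v v > 0" .
next
  fix c and u v :: "real \<times> real \<times> 'e" assume "c \<in> ind N"
  then obtain a b k where c: "c = (a, b, k)" and k: "k \<in> ind M" by (cases c) auto
  obtain r s x r' s' x' where uv: "u = (r, s, x)" "v = (r', s', x')" by (cases u; cases v)
  \<comment> \<open>The power and the quotient in \<open>g_eq\<close> are rewritten as sums and
    products, the shape that the closure rules accept.\<close>
  have "smooth_in_chart N c (\<lambda>p. 2 * r * r' + H (snd p) * (r * s' + s * r') +
      (H (snd p) * H (snd p) * (s * s' / 2) + s * s' / 2) + gR k (snd (snd p)) x x')"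
    unfolding c by (intro smooth_in_chart_add smooth_in_chart_mult smooth_in_chart_const H_smooth_N
        smooth_in_chart_M[where f = "\<lambda>m. gR k m x x'"] gR_smooth proper_chart_N k)
  moreover have "g c p u v = 2 * r * r' + H (snd p) * (r * s' + s * r') +
      (H (snd p) * H (snd p) * (s * s' / 2) + s * s' / 2) + gR k (snd (snd p)) x x'" if "p \<in> cdom N c" for p
    using that unfolding c uv by (cases p) (auto simp: g_eq[OF k] field_simps power2_eq_square)
  ultimately show "smooth_in_chart N c (\<lambda>p. g c p u v)"
    using smooth_in_chart_cong[OF proper_chart_N[OF k]] unfolding c by (metis (no_types, lifting))
next
  fix c c' p and u v :: "real \<times> real \<times> 'e"
  assume "c \<in> ind N" "c' \<in> ind N" "p \<in> cdom N c \<inter> cdom N c'"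
  then obtain a b k z w m a' b' k' where c: "c = (a, b, k)" "p = (z, w, m)" "c' = (a', b', k')"
    and k: "k \<in> ind M" "k' \<in> ind M" and p: "z \<in> cdom circle a \<inter> cdom circle a'"
    "w \<in> cdom circle b \<inter> cdom circle b'" "m \<in> cdom M k \<inter> cdom M k'"
    by (cases c; cases c'; cases p) auto
  have "gR k' m (cderiv M k (crd M k') m x) (cderiv M k (crd M k') m x') = gR k m x x'" for x x'
    using metric_M k p(3) by (auto simp: riemannian_metric_def)
  then show "g c' p (cderiv N c (crd N c') p u) (cderiv N c (crd N c') p v) = g c p u v"
    using p(3) by (cases u; cases v) (simp add: c transition_N[OF k p] g_eq k del: prod_manifold_simps circle_simps)
qed

lemma almost_complex_N: "almost_complex N J"
  unfolding almost_complex_def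
proof (intro conjI ballI allI)
  fix c p assume "c \<in> ind N" "p \<in> cdom N c"
  then obtain a b k z w m where c: "c = (a, b, k)" "p = (z, w, m)" and km: "k \<in> ind M" "m \<in> cdom M k"
    by (cases c; cases p) auto
  show "linear (J c p)" unfolding c by (rule pp_J_linear) (use km gR_bilinear JR_linear in auto)
  show "J c p (J c p u) = - u" for u
    by (cases u) (simp add: c J_eq[OF km] JR_JR[OF km] field_simps power2_eq_square)
next
  fix c and u :: "real \<times> real \<times> 'e" assume "c \<in> ind N"
  then obtain a b k where c: "c = (a, b, k)" and k: "k \<in> ind M" by (cases c) auto
  obtain r s x where u: "u = (r, s, x)" by (cases u)
  have inclusion: "bounded_linear (\<lambda>y :: 'e. (0 :: real, 0 :: real, y))"
    by (intro bounded_linear_Pair bounded_linear_zero bounded_linear_ident)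
  have "smooth_in_chart N c (\<lambda>p. (H (snd p) * r + (H (snd p) * H (snd p) * (s / 2) + s / 2)) *\<^sub>R (1 :: real, 0 :: real, 0) +
      (- 2 * r + H (snd p) * (- s)) *\<^sub>R (0, 1, 0) + (0, 0, JR k (snd (snd p)) x))"
    unfolding c by (intro smooth_in_chart_add smooth_in_chart_mult smooth_in_chart_scaleR smooth_in_chart_const H_smooth_N
        smooth_in_chart_bounded_linear[OF _ inclusion]
        smooth_in_chart_M[where f = "\<lambda>m. JR k m x"] JR_smooth proper_chart_N k)
  moreover have "J c p u = (H (snd p) * r + (H (snd p) * H (snd p) * (s / 2) + s / 2)) *\<^sub>R (1 :: real, 0 :: real, 0) +
      (- 2 * r + H (snd p) * (- s)) *\<^sub>R (0, 1, 0) + (0, 0, JR k (snd (snd p)) x)" if "p \<in> cdom N c" for p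
    using that unfolding c u by (cases p) (auto simp: J_eq[OF k] field_simps power2_eq_square)
  ultimately show "smooth_in_chart N c (\<lambda>p. J c p u)"
    using smooth_in_chart_cong[OF proper_chart_N[OF k]] unfolding c by (metis (no_types, lifting))
next
  fix c c' p and u :: "real \<times> real \<times> 'e"
  assume "c \<in> ind N" "c' \<in> ind N" "p \<in> cdom N c \<inter> cdom N c'"
  then obtain a b k z w m a' b' k' where c: "c = (a, b, k)" "p = (z, w, m)" "c' = (a', b', k')"
    and k: "k \<in> ind M" "k' \<in> ind M" and p: "z \<in> cdom circle a \<inter> cdom circle a'"
    "w \<in> cdom circle b \<inter> cdom circle b'" "m \<in> cdom M k \<inter> cdom M k'"
    by (cases c; cases c'; cases p) auto
  have "JR k' m (cderiv M k (crd M k') m x) = cderiv M k (crd M k') m (JR k m x)" for x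
    using acs_M k p(3) by (auto simp: almost_complex_def)
  then show "J c' p (cderiv N c (crd N c') p u) = cderiv N c (crd N c') p (J c p u)"
    using p(3) by (cases u) (simp add: c transition_N[OF k p] J_eq k del: prod_manifold_simps circle_simps)
qed

lemma compatible_N: "compatible N g J"
  unfolding compatible_def
proof (intro ballI allI)
  fix c p and u v :: "real \<times> real \<times> 'e" assume "c \<in> ind N" "p \<in> cdom N c"
  then obtain a b k z w m where c: "c = (a, b, k)" "p = (z, w, m)" and km: "k \<in> ind M" "m \<in> cdom M k"
    by (cases c; cases p) auto
  show "g c p (J c p u) (J c p v) = g c p u v"
    by (cases u; cases v) (simp add: c J_eq[OF km] g_eq[OF km] gR_JR[OF km] field_simps power2_eq_square)
qed

lemma omega_has_cderiv:
  assumes "k \<in> ind M" "z \<in> cdom circle a" "w \<in> cdom circle b" "m \<in> cdom M k"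
  shows "has_cderiv N (a, b, k) (\<lambda>q. g (a, b, k) q (r, s, u) (J (a, b, k) q (r', s', u'))) (z, w, m)
    (\<lambda>v. d_omega_R k m u u' (snd (snd v)))"
proof (rule has_cderiv_cong[OF proper_chart_N[OF assms(1)]])
  show "(z, w, m) \<in> cdom N (a, b, k)" using assms by simp
  show "has_cderiv N (a, b, k) (\<lambda>q. r * s' - s * r' + gR k (snd (snd q)) u (JR k (snd (snd q)) u')) (z, w, m)
    (\<lambda>v. d_omega_R k m u u' (snd (snd v)))"
    using has_cderiv_add[OF has_cderiv_const has_cderiv_M[OF assms omega_R_has_cderiv[OF assms(1,4)]]] by simp
  show "r * s' - s * r' + gR k (snd (snd q)) u (JR k (snd (snd q)) u') =
      g (a, b, k) q (r, s, u) (J (a, b, k) q (r', s', u'))" if "q \<in> cdom N (a, b, k)" for q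
    using that by (cases q) (simp add: omega_eq[OF assms(1)])
qed

lemma closed_N: "closed_form N 2 (fundamental_form g J)"
  unfolding closed_form_def
proof (intro ballI allI impI)
  fix c p and vs :: "(real \<times> real \<times> 'e) list" assume "c \<in> ind N" "p \<in> cdom N c" "length vs = Suc 2"
  then obtain a b k z w m x y v where c: "c = (a, b, k)" "p = (z, w, m)" and k: "k \<in> ind M"
    and p: "z \<in> cdom circle a" "w \<in> cdom circle b" "m \<in> cdom M k" and vs: "vs = [x, y, v]"
    by (cases c; cases p) (auto simp: length_Suc_conv numeral_2_eq_2)
  have "cderiv N (a, b, k) (\<lambda>q. g (a, b, k) q x (J (a, b, k) q y)) (z, w, m) v =
      d_omega_R k m (snd (snd x)) (snd (snd y)) (snd (snd v))" for x y v
    using cderiv_eq[OF omega_has_cderiv[OF k p]] by (cases x; cases y) simp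
  then have "ext_deriv N (fundamental_form g J) c p vs =
      d_omega_R k m (snd (snd y)) (snd (snd v)) (snd (snd x)) - d_omega_R k m (snd (snd x)) (snd (snd v)) (snd (snd y)) +
      d_omega_R k m (snd (snd x)) (snd (snd y)) (snd (snd v))"
    unfolding c vs ext_deriv_def by (simp add: fundamental_form_def lessThan_Suc numeral_2_eq_2)
  then show "ext_deriv N (fundamental_form g J) c p vs = 0"
    using d_omega_R_cyclic[OF k p(3), of "snd (snd x)" "snd (snd y)" "snd (snd v)"]
      d_omega_R_skew[OF k p(3), of "snd (snd x)" "snd (snd v)"] by simp
qed

lemma almost_kaehler_N: "almost_kaehler N g J"
  using almost_kaehler_M riemannian_metric_N almost_complex_N compatible_N closed_N
  by (simp add: almost_kaehler_def)

section \<open>Co-closedness with respect to \<open>h\<close>\<close>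

lemma N_cases:
  assumes "c \<in> ind N" "p \<in> cdom N c"
  obtains a b k z w m where "c = (a, b, k)" "p = (z, w, m)" "k \<in> ind M"
    "z \<in> cdom circle a" "w \<in> cdom circle b" "m \<in> cdom M k"
  using assms by (cases c; cases p) auto

text \<open>Raising the indices of the fundamental form of \<open>g\<close> with \<open>h\<close> flips the sign of the part on the
  torus relative to the part on \<open>M\<close>. Hence the closed form to invert is \<open>-d\<phi> \<and> d\<theta> + \<omega>\<^sub>R\<close>, and
  \<open>twist\<close> is the endomorphism that corresponds to it under \<open>h\<close>.\<close>

definition twist :: "(complex \<times> complex \<times> 'a, real \<times> real \<times> 'i, real \<times> real \<times> 'e) endo" where
  "twist = (\<lambda>(a, b, k) (z, w, m) (r, s, u). (r + H (w, m) * s, - s, JR k m u))"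

lemma h_eq:
  "h (a, b, k) (z, w, m) (r, s, u) (r', s', u') = (r * s' + s * r') + H (w, m) * s * s' + gR k m u u'"
  by (simp add: pp_metric_def)

lemma h_twist:
  "h (a, b, k) (z, w, m) (r, s, u) (twist (a, b, k) (z, w, m) (r', s', u')) =
    s * r' - r * s' + gR k m u (JR k m u')"
  by (simp add: pp_metric_def twist_def algebra_simps)

lemma coclosed_N: "coclosed N h 2 (fundamental_form g J)"
proof (rule coclosed_of_closed_inverse[where N = N and h = h and \<beta> = "fundamental_form g J" and L = twist
      and W' = "\<lambda>c p x y v. d_omega_R (snd (snd c)) (snd (snd p)) (snd (snd x)) (snd (snd y)) (snd (snd v))"])
  show "proper_chart N c" if "c \<in> ind N" for c
    using that proper_chart_N by (cases c) auto
  show "2 \<le> DIM(real \<times> real \<times> 'e)" by simp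
next
  fix c p assume "c \<in> ind N" "p \<in> cdom N c"
  then obtain a b k z w m where c: "c = (a, b, k)" "p = (z, w, m)" and km: "k \<in> ind M" "m \<in> cdom M k"
    and zw: "z \<in> cdom circle a" "w \<in> cdom circle b"
    by (rule N_cases)
  note bil = gR_bilinear[OF km] and lin = JR_linear[OF km]
  show "bilinear (h c p)"
    unfolding bilinear_def c
    by (intro conjI allI linearI)
      (auto simp: pp_metric_def bilinear_radd[OF bil] bilinear_ladd[OF bil]
        bilinear_rmul[OF bil] bilinear_lmul[OF bil] field_simps)
  show "h c p x y = h c p y x" for x y
    using gR_sym[OF km, of "snd (snd x)" "snd (snd y)"]
    by (cases x; cases y) (simp add: c pp_metric_def algebra_simps)
  show "x = 0" if nondeg: "\<And>y. h c p x y = 0" for x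
  proof -
    obtain r s u where x: "x = (r, s, u)" by (cases x)
    \<comment> \<open>Pairing with the first angular direction gives \<open>s\<close>, with the
      second one \<open>r + H * s\<close>, and with \<open>u\<close> itself the square of its
      length.\<close>
    have "s = 0" "r = 0" "gR k m u u = 0"
      using nondeg[of "(1, 0, 0)"] nondeg[of "(0, 1, 0)"] nondeg[of "(0, 0, u)"]
      by (simp_all add: c x pp_metric_def bilinear_rzero[OF bil])
    then show ?thesis using gR_pos[OF km, of u] by (auto simp: x zero_prod_def)
  qed
  show "linear (twist c p)"
    unfolding c by (intro linearI) (auto simp: twist_def linear_add[OF lin] linear_scale[OF lin] algebra_simps)
  \<comment> \<open>On the torus directions \<open>twist\<close> is an involution, while along
    \<open>M\<close> it is \<open>JR\<close>; only the fourth power is the identity on both.\<close>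
  show "twist c p (twist c p (twist c p (twist c p x))) = x" for x
    by (cases x) (simp add: c twist_def JR_JR[OF km] linear_neg[OF lin])
  show "bilinear (\<lambda>x y. fundamental_form g J c p [x, y])"
    unfolding bilinear_def c fundamental_form_def
    by (intro conjI allI linearI)
      (auto simp: omega_eq[OF km] linear_add[OF lin] linear_scale[OF lin] bilinear_radd[OF bil] bilinear_ladd[OF bil]
        bilinear_rmul[OF bil] bilinear_lmul[OF bil] algebra_simps)
  show "fundamental_form g J c p [y, x] = - fundamental_form g J c p [x, y]" for x y
    using gR_JR_skew[OF km, of "snd (snd y)" "snd (snd x)"]
    by (cases x; cases y) (simp add: c fundamental_form_def omega_eq[OF km])
  show "fundamental_form g J c p [x, twist c p y] = - h c p x y" for x y
    by (cases x; cases y)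
      (simp add: c fundamental_form_def twist_def omega_eq[OF km] h_eq JR_JR[OF km]
        bilinear_rneg[OF bil] algebra_simps)
  show "h c p y (twist c p x) = - h c p x (twist c p y)" for x y
    using gR_JR_skew[OF km, of "snd (snd y)" "snd (snd x)"]
    by (cases x; cases y) (simp add: c h_twist)
  show "has_cderiv N c (\<lambda>q. h c q x (twist c q y)) p
      (\<lambda>v. d_omega_R (snd (snd c)) (snd (snd p)) (snd (snd x)) (snd (snd y)) (snd (snd v)))" for x y
  proof -
    obtain r s u r' s' u' where xy: "x = (r, s, u)" "y = (r', s', u')" by (cases x; cases y)
    have "has_cderiv N (a, b, k) (\<lambda>q. (s * r' - r * s') + gR k (snd (snd q)) u (JR k (snd (snd q)) u')) (z, w, m)
        (\<lambda>v. 0 + d_omega_R k m u u' (snd (snd v)))"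
      by (rule has_cderiv_add[OF has_cderiv_const has_cderiv_M[OF km(1) zw km(2) omega_R_has_cderiv[OF km]]])
    moreover have "(\<lambda>q. h c q x (twist c q y)) =
        (\<lambda>q. (s * r' - r * s') + gR k (snd (snd q)) u (JR k (snd (snd q)) u'))"
      by (auto simp: fun_eq_iff c xy h_twist)
    ultimately show ?thesis by (simp add: c xy)
  qed
  show "d_omega_R (snd (snd c)) (snd (snd p)) (snd (snd x)) (snd (snd y)) (snd (snd v)) +
      d_omega_R (snd (snd c)) (snd (snd p)) (snd (snd y)) (snd (snd v)) (snd (snd x)) +
      d_omega_R (snd (snd c)) (snd (snd p)) (snd (snd v)) (snd (snd x)) (snd (snd y)) = 0" for x y v
    using d_omega_R_cyclic[OF km] by (simp add: c)
qed

section \<open>The Nijenhuis tensor of \<open>J\<close>\<close>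

lemma J_has_cderiv:
  assumes k: "k \<in> ind M" and p: "z \<in> cdom circle a" "w \<in> cdom circle b" "m \<in> cdom M k"
  defines "dH \<equiv> cderiv (circle \<times>\<^sub>M M) (b, k) H (w, m)"
  shows "has_cderiv N (a, b, k) (\<lambda>q. J (a, b, k) q (r, s, u)) (z, w, m)
    (\<lambda>v. (dH (snd v) * (r + H (w, m) * s), - (dH (snd v) * s), cderiv M k (\<lambda>m. JR k m u) m (snd (snd v))))"
proof (rule has_cderiv_cong[OF proper_chart_N[OF k]])
  show p': "(z, w, m) \<in> cdom N (a, b, k)" using p by simp
  have H': "has_cderiv N (a, b, k) (\<lambda>q. H (snd q)) (z, w, m) (\<lambda>v. dH (snd v))"
    unfolding dH_def using p k
    by (intro has_cderiv_snd[OF proper_chart_circle proper_chart_circle_M] smooth_in_chart_has_cderiv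
        proper_chart_circle_M H_smooth) auto
  have "has_cderiv N (a, b, k) (\<lambda>q. H (snd q) * r + (H (snd q) * H (snd q) * (s / 2) + s / 2)) (z, w, m)
      (\<lambda>v. dH (snd v) * r + ((H (snd (z, w, m)) * dH (snd v) + dH (snd v) * H (snd (z, w, m))) * (s / 2) + 0))"
    by (intro has_cderiv_add has_cderiv_const has_cderiv_bounded_linear[OF bounded_linear_mult_left] H'
        has_cderiv_bilinear[OF bounded_bilinear_mult proper_chart_N[OF k] p' H' H'])
  then have "has_cderiv N (a, b, k) (\<lambda>q. H (snd q) * r + (H (snd q) * H (snd q) * (s / 2) + s / 2)) (z, w, m)
      (\<lambda>v. dH (snd v) * (r + H (w, m) * s))"
    by (simp add: algebra_simps)
  moreover have "has_cderiv N (a, b, k) (\<lambda>q. - 2 * r + H (snd q) * (- s)) (z, w, m) (\<lambda>v. 0 + dH (snd v) * (- s))"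
    by (intro has_cderiv_add has_cderiv_const has_cderiv_bounded_linear[OF bounded_linear_mult_left] H')
  moreover have "has_cderiv N (a, b, k) (\<lambda>q. JR k (snd (snd q)) u) (z, w, m)
      (\<lambda>v. cderiv M k (\<lambda>m. JR k m u) m (snd (snd v)))"
    by (intro has_cderiv_M[where f = "\<lambda>m. JR k m u"] k p smooth_in_chart_has_cderiv proper_chart_M JR_smooth)
  ultimately show "has_cderiv N (a, b, k) (\<lambda>q. (H (snd q) * r + (H (snd q) * H (snd q) * (s / 2) + s / 2),
      - 2 * r + H (snd q) * (- s), JR k (snd (snd q)) u)) (z, w, m)
      (\<lambda>v. (dH (snd v) * (r + H (w, m) * s), - (dH (snd v) * s), cderiv M k (\<lambda>m. JR k m u) m (snd (snd v))))"
    by (intro has_cderiv_Pair) simp_all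
  show "(H (snd q) * r + (H (snd q) * H (snd q) * (s / 2) + s / 2), - 2 * r + H (snd q) * (- s), JR k (snd (snd q)) u) =
      J (a, b, k) q (r, s, u)" if "q \<in> cdom N (a, b, k)" for q
    using that by (cases q) (simp add: J_eq[OF k] field_simps power2_eq_square)
qed

text \<open>The derivative \<eta> along the second circle drops out: it can only enter for two torus
  vectors, and there the tensor is that of a surface, which vanishes identically.\<close>

lemma nij_at_N:
  assumes k: "k \<in> ind M" and p: "z \<in> cdom circle a" "w \<in> cdom circle b" "m \<in> cdom M k"
  defines "\<eta> \<equiv> cderiv (circle \<times>\<^sub>M M) (b, k) H (w, m) (1, 0)"
    and "dH \<equiv> \<lambda>v. cderiv (circle \<times>\<^sub>M M) (b, k) H (w, m) (0, v)" and "x \<equiv> H (w, m)"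
  shows "nij_at N J (a, b, k) (z, w, m) (r, s, u) (r', s', u') =
    (dH (JR k m u) * (r' + x * s') - dH (JR k m u') * (r + x * s)
        + dH u' * (x * r + (x\<^sup>2 - 1) / 2 * s) - dH u * (x * r' + (x\<^sup>2 - 1) / 2 * s'),
      dH (JR k m u') * s - dH (JR k m u) * s' - dH u' * (2 * r + x * s) + dH u * (2 * r' + x * s'),
      nij_at M JR k m u u')"
proof -
  let ?D = "cderiv (circle \<times>\<^sub>M M) (b, k) H (w, m)"
  have "linear ?D"
    using k p by (intro has_cderiv_linear[OF smooth_in_chart_has_cderiv] proper_chart_circle_M H_smooth) auto
  then have D: "?D (s, u) = s * \<eta> + dH u" for s u
    using linear_add[of ?D "s *\<^sub>R (1, 0)" "(0, u)"] linear_scale[of ?D s "(1, 0)"] by (simp add: \<eta>_def dH_def)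
  show ?thesis
    unfolding nij_at_def Let_def J_eq[OF k p(3)] cderiv_eq[OF J_has_cderiv[OF k p]] D snd_conv
    by (simp add: J_eq[OF k p(3)] D x_def field_simps power2_eq_square)
qed

lemma integrable_N_iff: "integrable_acs N J \<longleftrightarrow> constant_on_M M H \<and> integrable_acs M JR"
proof -
  have N: "integrable_acs N J \<longleftrightarrow> (\<forall>c\<in>ind N. \<forall>p\<in>cdom N c. \<forall>u v. nij_at N J c p u v = 0)"
    using proper_chart_N by (intro integrable_acs_iff almost_complex_N) auto
  have M: "integrable_acs M JR \<longleftrightarrow> (\<forall>k\<in>ind M. \<forall>m\<in>cdom M k. \<forall>u v. nij_at M JR k m u v = 0)"
    using proper_chart_M by (intro integrable_acs_iff acs_M) auto
  obtain a0 z0 where z: "z0 \<in> cdom circle a0" using cis_in_circle_chart by blast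
  show ?thesis
  proof
    assume "integrable_acs N J"
    then have nij: "nij_at N J (a, b, k) (z, w, m) u v = 0"
      if "k \<in> ind M" "z \<in> cdom circle a" "w \<in> cdom circle b" "m \<in> cdom M k" for a b k z w m u v
    proof -
      have "(a, b, k) \<in> ind N" "(z, w, m) \<in> cdom N (a, b, k)" using that by simp_all
      then show ?thesis using N \<open>integrable_acs N J\<close> by blast
    qed
    have "cderiv (circle \<times>\<^sub>M M) (b, k) H (w, m) (0, v) = 0"
      if "k \<in> ind M" "w \<in> cdom circle b" "m \<in> cdom M k" for b k w m v
    proof -
      have "snd (nij_at N J (a0, b, k) (z0, w, m) (1, 0, 0) (0, 0, v)) = 0"
        unfolding nij[OF that(1) z that(2,3)] by (simp add: zero_prod_def)
      then show ?thesis by (simp add: nij_at_N[OF that(1) z that(2,3)] zero_prod_def)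
    qed
    then have "constant_on_M M H" by (auto simp: constant_on_M_def)
    moreover have "nij_at M JR k m u v = 0" if "k \<in> ind M" "m \<in> cdom M k" for k m u v
    proof -
      have "snd (snd (nij_at N J (a0, a0, k) (z0, z0, m) (0, 0, u) (0, 0, v))) = 0"
        unfolding nij[OF that(1) z z that(2)] by (simp add: zero_prod_def)
      then show ?thesis by (simp add: nij_at_N[OF that(1) z z that(2)])
    qed
    ultimately show "constant_on_M M H \<and> integrable_acs M JR" using M by blast
  next
    assume const: "constant_on_M M H \<and> integrable_acs M JR"
    have "nij_at N J c p x y = 0" if "c \<in> ind N" "p \<in> cdom N c" for c p x y
    proof -
      obtain a b k z w m where c: "c = (a, b, k)" "p = (z, w, m)" and k: "k \<in> ind M"
        and p: "z \<in> cdom circle a" "w \<in> cdom circle b" "m \<in> cdom M k"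
        using \<open>c \<in> ind N\<close> \<open>p \<in> cdom N c\<close> by (rule N_cases)
      have "cderiv (circle \<times>\<^sub>M M) (b, k) H (w, m) (0, v) = 0" for v
        using const k p by (auto simp: constant_on_M_def simp del: circle_simps(2-))
      moreover have "nij_at M JR k m u v = 0" for u v using const M k p by blast
      ultimately show ?thesis
        by (cases x; cases y) (simp add: c nij_at_N[OF k p] zero_prod_def)
    qed
    then show "integrable_acs N J" using N by blast
  qed
qed

text \<open>In a product chart \<open>H\<close> factors through the angle, so by the chain rule its
  derivative kills \<open>(0, u)\<close>. Constancy within each chart domain is enough because
  \<open>constant_on_M\<close> speaks of derivatives only.\<close>

lemma constant_on_M_if_locally_constant:
  assumes const: "\<And>b k w m m'. k \<in> ind M \<Longrightarrow> w \<in> cdom circle b \<Longrightarrow> m \<in> cdom M k \<Longrightarrow> m' \<in> cdom M k \<Longrightarrow>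
    H (w, m) = H (w, m')"
  shows "constant_on_M M H"
  unfolding constant_on_M_def
proof (intro ballI allI)
  fix c p u assume "c \<in> ind (circle \<times>\<^sub>M M)" "p \<in> cdom (circle \<times>\<^sub>M M) c"
  then obtain b k w m where c: "c = (b, k)" "p = (w, m)" and k: "k \<in> ind M"
    and p: "w \<in> cdom circle b" "m \<in> cdom M k"
    by (cases c; cases p) auto
  let ?F = "\<lambda>x. H (param (circle \<times>\<^sub>M M) (b, k) x)" and ?D = "cderiv (circle \<times>\<^sub>M M) (b, k) H (w, m)"
  let ?S = "(crd circle b ` cdom circle b) \<times> (crd M k ` cdom M k)"
  have D: "has_cderiv (circle \<times>\<^sub>M M) (b, k) H (w, m) ?D"
    using k p by (intro smooth_in_chart_has_cderiv proper_chart_circle_M H_smooth) auto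
  have x0: "crd (circle \<times>\<^sub>M M) (b, k) (w, m) = (crd circle b w, crd M k m)"
    unfolding prod_manifold_simps by simp
  have FD: "(?F has_derivative ?D) (at (crd circle b w, crd M k m))"
    using D unfolding has_cderiv_def x0 .
  have "((\<lambda>z. (fst z, crd M k m)) has_derivative (\<lambda>v. (fst v, 0))) (at (crd circle b w, crd M k m))"
    by (auto intro!: derivative_eq_intros)
  then have "((\<lambda>z. ?F (fst z, crd M k m)) has_derivative (\<lambda>v. ?D (fst v, 0))) (at (crd circle b w, crd M k m))"
    by (rule has_derivative_compose) (use FD in simp)
  then have "(?F has_derivative (\<lambda>v. ?D (fst v, 0))) (at (crd circle b w, crd M k m))"
  proof (rule has_derivative_transform_within_open[of _ _ _ _ ?S])
    show "open ?S" using proper_chart_circle[of b] proper_chart_M[OF k] by (auto simp: proper_chart_def open_Times)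
    show "(crd circle b w, crd M k m) \<in> ?S" using p by blast
    fix x assume "x \<in> ?S"
    then obtain y e where x: "x = (y, e)" and y: "y \<in> crd circle b ` cdom circle b" and e: "e \<in> crd M k ` cdom M k"
      by (cases x) auto
    have m: "crd M k m \<in> crd M k ` cdom M k" using p(2) by simp
    show "?F (fst x, crd M k m) = ?F x"
      using const[OF k param_in_cdom[OF y] param_in_cdom[OF m] param_in_cdom[OF e]]
      by (simp add: x param_prod[OF proper_chart_circle proper_chart_M[OF k] y] m e del: circle_simps)
  qed
  from has_derivative_unique[OF FD this] have "?D (0, u) = ?D (0, 0)" by (metis fst_conv)
  also have "\<dots> = 0" using linear_0[OF has_cderiv_linear[OF D]] by (simp add: zero_prod_def)
  finally show "cderiv (circle \<times>\<^sub>M M) c H p (0, u) = 0" by (simp add: c)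
qed

end

section \<open>Warped products\<close>

lemma circle_cover:
  assumes "z \<in> topspace (mtop circle)"
  shows "\<exists>a. z \<in> cdom circle a"
proof -
  have "norm z = 1" using assms by simp
  then have "z = cis (Arg z)" by (metis cis_Arg norm_eq_zero sgn_div_norm inverse_1 scaleR_one zero_neq_one)
  then show ?thesis using cis_in_circle_chart by metis
qed

lemma warped_with_cross_zero:
  assumes "warped_with B F f G" "i \<in> ind B" "j \<in> ind F" "p \<in> cdom B i" "q \<in> cdom F j"
  shows "G (i, j) (p, q) (u, 0) (0, v) = 0"
proof -
  obtain gB gF where "riemannian_metric B gB" "riemannian_metric F gF"
    and G: "G (i, j) (p, q) (u, 0) (0, v) = gB i p u 0 + (f p)\<^sup>2 * gF j q 0 v"
    using assms unfolding warped_with_def by blast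
  then have "bilinear (gB i p)" "bilinear (gF j q)"
    using assms by (auto simp: riemannian_metric_def)
  then show ?thesis by (simp add: G bilinear_rzero bilinear_lzero)
qed

text \<open>Freezing a point of the fibre exposes the square of \<open>f\<close> as a conformal
  factor: a single form \<gamma> serves all charts and points of the base.\<close>

lemma warped_with_fibre:
  assumes "warped_with B F f G" "j \<in> ind F" "q \<in> cdom F j"
  obtains \<gamma> where "\<And>v. v \<noteq> 0 \<Longrightarrow> \<gamma> v v > 0"
    and "\<And>i p v v'. i \<in> ind B \<Longrightarrow> p \<in> cdom B i \<Longrightarrow> G (i, j) (p, q) (0, v) (0, v') = (f p)\<^sup>2 * \<gamma> v v'"
proof -
  obtain gB gF where B: "riemannian_metric B gB" and F: "riemannian_metric F gF"
    and G: "\<And>i p v v'. i \<in> ind B \<Longrightarrow> p \<in> cdom B i \<Longrightarrow>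
      G (i, j) (p, q) (0, v) (0, v') = gB i p 0 0 + (f p)\<^sup>2 * gF j q v v'"
    using assms unfolding warped_with_def by blast
  have "bilinear (gB i p)" if "i \<in> ind B" "p \<in> cdom B i" for i p
    using B that by (auto simp: riemannian_metric_def)
  then show ?thesis
    using F assms(2,3) by (intro that[of "gF j q"]) (auto simp: G bilinear_rzero riemannian_metric_def)
qed

lemma warped_with_constant:
  assumes W: "warped_with B F f G" and j: "j \<in> ind F" "q \<in> cdom F j"
    and cover: "\<And>p. p \<in> topspace (mtop B) \<Longrightarrow> \<exists>i\<in>ind B. p \<in> cdom B i"
    and v: "v \<noteq> 0"
    and C: "\<And>i p. i \<in> ind B \<Longrightarrow> p \<in> cdom B i \<Longrightarrow> G (i, j) (p, q) (0, v) (0, v) = C"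
  shows "\<exists>c. \<forall>p\<in>topspace (mtop B). f p = c"
proof -
  obtain \<gamma> where \<gamma>: "\<And>v. v \<noteq> 0 \<Longrightarrow> \<gamma> v v > 0"
    "\<And>i p v v'. i \<in> ind B \<Longrightarrow> p \<in> cdom B i \<Longrightarrow> G (i, j) (p, q) (0, v) (0, v') = (f p)\<^sup>2 * \<gamma> v v'"
    using warped_with_fibre[OF W j] by blast
  have "f p = sqrt (C / \<gamma> v v)" if p: "p \<in> topspace (mtop B)" for p
  proof -
    obtain i where i: "i \<in> ind B" "p \<in> cdom B i" using cover[OF p] by blast
    have "f p > 0" using W p by (simp add: warped_with_def)
    moreover have "(f p)\<^sup>2 = C / \<gamma> v v"
      using \<gamma>(1)[OF v] \<gamma>(2)[OF i] C[OF i] by (simp add: field_simps)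
    ultimately show ?thesis by (simp add: real_sqrt_unique)
  qed
  then show ?thesis by blast
qed

lemma cover_circle: "z \<in> topspace (mtop circle) \<Longrightarrow> \<exists>a\<in>ind circle. z \<in> cdom circle a"
  using circle_cover by (metis UNIV_I circle_simps(1))

lemma cover_prod:
  assumes "\<And>p. p \<in> topspace (mtop X) \<Longrightarrow> \<exists>i\<in>ind X. p \<in> cdom X i"
    and "\<And>q. q \<in> topspace (mtop Y) \<Longrightarrow> \<exists>j\<in>ind Y. q \<in> cdom Y j"
    and "p \<in> topspace (mtop (X \<times>\<^sub>M Y))"
  shows "\<exists>i\<in>ind (X \<times>\<^sub>M Y). p \<in> cdom (X \<times>\<^sub>M Y) i"
  using assms(1)[of "fst p"] assms(2)[of "snd p"] assms(3) by (cases p) fastforce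

section \<open>The six groupings of the factors\<close>

context almost_kaehler_pp
begin

lemma M_cover: "m \<in> topspace (mtop M) \<Longrightarrow> \<exists>k\<in>ind M. m \<in> cdom M k"
  using M by (auto simp: smooth_manifold_def)

lemma obtain_chart_M:
  obtains k m where "k \<in> ind M" "m \<in> cdom M k"
proof -
  have "topspace (mtop M) \<noteq> {}" using M unfolding smooth_manifold_def by blast
  then obtain m where "m \<in> topspace (mtop M)" by blast
  then show ?thesis using M_cover that by blast
qed

lemmas regroup_defs = pull_tensor_def regroup2_def regroup3_def regroup4_def regroup5_def regroup6_def

lemma cross_zero_imp_H_zero:
  assumes "k \<in> ind M" "m \<in> cdom M k" "g (a, b, k) (z, w, m) (1, 0, 0) (0, 1, 0) = 0"
  shows "H (w, m) = 0"
  using assms(3) bilinear_lzero[OF gR_bilinear[OF assms(1,2)]] by (simp add: g_eq[OF assms(1,2)])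

text \<open>Two kinds of vectors have a length that does not vary over the base: the first angular
  direction, of squared length 2, and a vector tangent to \<open>M\<close> at a frozen point. One of
  them lies in the fibre unless the fibre is the second circle alone.\<close>

lemma not_proper_warped: "\<not> proper_warped_product3 circle circle M g"
proof -
  obtain k m where km: "k \<in> ind M" "m \<in> cdom M k" by (rule obtain_chart_M)
  obtain e :: 'e where e: "e \<noteq> 0" using nonzero_Basis SOME_Basis by blast
  obtain a0 z0 where z: "z0 \<in> cdom circle a0" using cis_in_circle_chart by blast
  have gR0: "gR k m 0 0 = 0" if "k \<in> ind M" "m \<in> cdom M k" for k m
    using bilinear_lzero[OF gR_bilinear[OF that]] .
  note covers = cover_circle M_cover cover_prod
  have "\<not> proper_warped_product circle (circle \<times>\<^sub>M M) g"
  proof -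
    have "\<exists>c. \<forall>p\<in>topspace (mtop circle). f p = c" if "warped_with circle (circle \<times>\<^sub>M M) f g" for f
      by (rule warped_with_constant[OF that, of "(a0, k)" "(z0, m)" "(0, e)" "gR k m e e"])
        (use km z e covers in \<open>auto simp: g_eq zero_prod_def simp del: circle_simps(2-)\<close>)
    then show ?thesis unfolding proper_warped_product_def by blast
  qed
  moreover have "\<not> proper_warped_product (circle \<times>\<^sub>M M) circle (pull_tensor regroup2 regroup2 regroup2 g)"
  proof -
    have "\<exists>c. \<forall>p\<in>topspace (mtop (circle \<times>\<^sub>M M)). f p = c"
      if "warped_with (circle \<times>\<^sub>M M) circle f (pull_tensor regroup2 regroup2 regroup2 g)" for f
    proof (rule warped_with_constant[OF that _ z, where v = 1 and C = 2])
      show "\<exists>i\<in>ind (circle \<times>\<^sub>M M). p \<in> cdom (circle \<times>\<^sub>M M) i" if "p \<in> topspace (mtop (circle \<times>\<^sub>M M))" for p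
        by (rule cover_prod[OF cover_circle M_cover that])
    qed (auto simp: regroup_defs g_eq gR0 zero_prod_def)
    then show ?thesis unfolding proper_warped_product_def by blast
  qed
  moreover have "\<not> proper_warped_product circle (circle \<times>\<^sub>M M) (pull_tensor regroup3 regroup3 regroup3 g)"
  proof -
    have "\<exists>c. \<forall>p\<in>topspace (mtop circle). f p = c"
      if "warped_with circle (circle \<times>\<^sub>M M) f (pull_tensor regroup3 regroup3 regroup3 g)" for f
      by (rule warped_with_constant[OF that, of "(a0, k)" "(z0, m)" "(1, 0)" 2])
        (use km z covers in \<open>auto simp: regroup_defs g_eq gR0 zero_prod_def simp del: circle_simps(2-)\<close>)
    then show ?thesis unfolding proper_warped_product_def by blast
  qed
  moreover have "\<not> proper_warped_product (circle \<times>\<^sub>M M) circle (pull_tensor regroup4 regroup4 regroup4 g)"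
  proof -
    have "\<exists>c. \<forall>p\<in>topspace (mtop (circle \<times>\<^sub>M M)). f p = c"
      if W: "warped_with (circle \<times>\<^sub>M M) circle f (pull_tensor regroup4 regroup4 regroup4 g)" for f
    \<comment> \<open>The exceptional grouping: the fibre direction has squared length
      \<open>(H^2 + 1) / 2\<close>. It is orthogonal to the first angular direction, which now lies
      in the base; this forces \<open>H = 0\<close> and leaves the constant 1/2.\<close>
    proof (rule warped_with_constant[OF W _ z, where v = 1 and C = "1/2"])
      show "\<exists>i\<in>ind (circle \<times>\<^sub>M M). p \<in> cdom (circle \<times>\<^sub>M M) i" if "p \<in> topspace (mtop (circle \<times>\<^sub>M M))" for p
        by (rule cover_prod[OF cover_circle M_cover that])
      fix i p assume i: "i \<in> ind (circle \<times>\<^sub>M M)" and p: "p \<in> cdom (circle \<times>\<^sub>M M) i"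
      obtain a k z m where c: "i = (a, k)" "p = (z, m)" by (cases i; cases p)
      have km: "k \<in> ind M" "m \<in> cdom M k" using i p c by auto
      have "H (z0, m) = 0"
        using warped_with_cross_zero[OF W i _ p z, of "(1, 0)" 1]
        by (intro cross_zero_imp_H_zero[OF km, of a "a0" z]) (simp add: c regroup_defs zero_prod_def)
      then show "pull_tensor regroup4 regroup4 regroup4 g (i, a0) (p, z0) (0, 1) (0, 1) = 1 / 2"
        by (simp add: c regroup_defs g_eq[OF km] gR0[OF km] zero_prod_def)
    qed auto
    then show ?thesis unfolding proper_warped_product_def by blast
  qed
  moreover have "\<not> proper_warped_product (circle \<times>\<^sub>M circle) M (pull_tensor regroup5 regroup5 regroup5 g)"
  proof -
    have "\<exists>c. \<forall>p\<in>topspace (mtop (circle \<times>\<^sub>M circle)). f p = c"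
      if "warped_with (circle \<times>\<^sub>M circle) M f (pull_tensor regroup5 regroup5 regroup5 g)" for f
    proof (rule warped_with_constant[OF that km _ e, where C = "gR k m e e"])
      show "\<exists>i\<in>ind (circle \<times>\<^sub>M circle). p \<in> cdom (circle \<times>\<^sub>M circle) i"
        if "p \<in> topspace (mtop (circle \<times>\<^sub>M circle))" for p
        by (rule cover_prod[OF cover_circle cover_circle that])
    qed (auto simp: regroup_defs g_eq[OF km] zero_prod_def)
    then show ?thesis unfolding proper_warped_product_def by blast
  qed
  moreover have "\<not> proper_warped_product M (circle \<times>\<^sub>M circle) (pull_tensor regroup6 regroup6 regroup6 g)"
  proof -
    have "\<exists>c. \<forall>p\<in>topspace (mtop M). f p = c"
      if "warped_with M (circle \<times>\<^sub>M circle) f (pull_tensor regroup6 regroup6 regroup6 g)" for f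
      by (rule warped_with_constant[OF that, of "(a0, a0)" "(z0, z0)" "(1, 0)" 2])
        (use z covers in \<open>auto simp: regroup_defs g_eq gR0 zero_prod_def simp del: circle_simps(2-)\<close>)
    then show ?thesis unfolding proper_warped_product_def by blast
  qed
  ultimately show ?thesis unfolding proper_warped_product3_def by blast
qed

lemma warped_imp_constant_on_M:
  assumes "warped_product3 circle circle M g"
  shows "constant_on_M M H"
proof (rule constant_on_M_if_locally_constant)
  fix b k w m m'
  assume k: "k \<in> ind M" and w: "w \<in> cdom circle b" and m: "m \<in> cdom M k" "m' \<in> cdom M k"
  obtain a0 z0 where z: "z0 \<in> cdom circle a0" using cis_in_circle_chart by blast
  have gR0: "gR k m 0 0 = 0" if "m \<in> cdom M k" for m
    using bilinear_lzero[OF gR_bilinear[OF k that]] .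
  note warped3 = assms[unfolded warped_product3_def warped_product_def]
  have zero_imp: "H (w, m) = H (w, m')" if "\<And>m. m \<in> cdom M k \<Longrightarrow> g (a0, b, k) (z0, w, m) (1, 0, 0) (0, 1, 0) = 0"
    using cross_zero_imp_H_zero[OF k _ that] m by simp
  consider (1) f where "warped_with circle (circle \<times>\<^sub>M M) f g"
    | (2) f where "warped_with (circle \<times>\<^sub>M M) circle f (pull_tensor regroup2 regroup2 regroup2 g)"
    | (3) f where "warped_with circle (circle \<times>\<^sub>M M) f (pull_tensor regroup3 regroup3 regroup3 g)"
    | (4) f where "warped_with (circle \<times>\<^sub>M M) circle f (pull_tensor regroup4 regroup4 regroup4 g)"
    | (5) f where "warped_with (circle \<times>\<^sub>M circle) M f (pull_tensor regroup5 regroup5 regroup5 g)"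
    | (6) f where "warped_with M (circle \<times>\<^sub>M circle) f (pull_tensor regroup6 regroup6 regroup6 g)"
    using warped3 by blast
  then show "H (w, m) = H (w, m')"
  proof cases
    case 1
    show ?thesis
    proof (rule zero_imp)
      fix m assume "m \<in> cdom M k"
      then show "g (a0, b, k) (z0, w, m) (1, 0, 0) (0, 1, 0) = 0"
        using warped_with_cross_zero[OF 1, of "a0" "(b, k)" "z0" "(w, m)" 1 "(1, 0)"] k w z
        by (simp add: zero_prod_def del: circle_simps(2-))
    qed
  next
    case 2
    show ?thesis
    proof (rule zero_imp)
      fix m assume m: "m \<in> cdom M k"
      then have "g (a0, b, k) (z0, w, m) (0, 1, 0) (1, 0, 0) = 0"
        using warped_with_cross_zero[OF 2, of "(b, k)" "a0" "(w, m)" "z0" "(1, 0)" 1] k w z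
        by (simp add: zero_prod_def regroup_defs del: circle_simps(2-))
      then show "g (a0, b, k) (z0, w, m) (1, 0, 0) (0, 1, 0) = 0"
        by (simp add: g_eq[OF k m])
    qed
  next
    case 3
    show ?thesis
    proof (rule zero_imp)
      fix m assume m: "m \<in> cdom M k"
      then have "g (a0, b, k) (z0, w, m) (0, 1, 0) (1, 0, 0) = 0"
        using warped_with_cross_zero[OF 3, of b "(a0, k)" w "(z0, m)" 1 "(1, 0)"] k w z
        by (simp add: zero_prod_def regroup_defs del: circle_simps(2-))
      then show "g (a0, b, k) (z0, w, m) (1, 0, 0) (0, 1, 0) = 0"
        by (simp add: g_eq[OF k m])
    qed
  next
    case 4
    show ?thesis
    proof (rule zero_imp)
      fix m assume "m \<in> cdom M k"
      then show "g (a0, b, k) (z0, w, m) (1, 0, 0) (0, 1, 0) = 0"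
        using warped_with_cross_zero[OF 4, of "(a0, k)" b "(z0, m)" w "(1, 0)" 1] k w z
        by (simp add: zero_prod_def regroup_defs del: circle_simps(2-))
    qed
  next
    case 5
    then obtain gB gF where "riemannian_metric M gF" and
      G: "\<And>m. m \<in> cdom M k \<Longrightarrow> pull_tensor regroup5 regroup5 regroup5 g ((a0, b), k) ((z0, w), m)
        ((1, 0), 0) ((0, 1), 0) = gB (a0, b) (z0, w) (1, 0) (0, 1) + (f (z0, w))\<^sup>2 * gF k m 0 0"
      unfolding warped_with_def using k w z by (auto simp del: circle_simps(2-))
    then have "bilinear (gF k m)" if "m \<in> cdom M k" for m
      using k that by (auto simp: riemannian_metric_def)
    \<comment> \<open>Both test vectors have zero fibre component, so \<open>f\<close> drops out and
      what remains does not involve \<open>m\<close>.\<close>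
    then have "H (w, m) = gB (a0, b) (z0, w) (1, 0) (0, 1)" if "m \<in> cdom M k" for m
      using G[OF that] that by (simp add: regroup_defs g_eq[OF k] gR0 bilinear_lzero)
    with m show ?thesis by simp
  next
    case 6
    obtain \<gamma> where \<gamma>: "\<And>v. v \<noteq> 0 \<Longrightarrow> \<gamma> v v > 0"
      "\<And>k m v v'. k \<in> ind M \<Longrightarrow> m \<in> cdom M k \<Longrightarrow> pull_tensor regroup6 regroup6 regroup6 g
        (k, (a0, b)) (m, (z0, w)) (0, v) (0, v') = (f m)\<^sup>2 * \<gamma> v v'"
      by (rule warped_with_fibre[OF 6, of "(a0, b)" "(z0, w)"]) (use w z in \<open>auto simp del: circle_simps(2-)\<close>)
    \<comment> \<open>Here \<open>f\<close> could depend on \<open>m\<close>, but the squared length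
      2 of the first angular direction fixes its square, and then the mixed component fixes
      \<open>H\<close>.\<close>
    have f: "(f m)\<^sup>2 * \<gamma> (1, 0) (1, 0) = 2" "(f m)\<^sup>2 * \<gamma> (1, 0) (0, 1) = H (w, m)" if "m \<in> cdom M k" for m
      using \<gamma>(2)[OF k that, of "(1, 0)" "(1, 0)"] \<gamma>(2)[OF k that, of "(1, 0)" "(0, 1)"]
      by (simp_all add: regroup_defs g_eq[OF k that] gR0[OF that])
    have "\<gamma> (1, 0) (1, 0) > 0" by (rule \<gamma>(1)) (simp add: zero_prod_def)
    then have "(f m)\<^sup>2 = (f m')\<^sup>2"
      using f(1)[OF m(1)] f(1)[OF m(2)] by (metis mult_right_cancel less_irrefl)
    then show ?thesis using f(2)[OF m(1)] f(2)[OF m(2)] by simp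
  qed
qed

end

theorem theorem2:
  fixes M :: "('a, 'i, 'e::euclidean_space) manifold"
    and gR :: "('a, 'i, 'e) tensor2"
    and JR :: "('a, 'i, 'e) endo"
    and H :: "complex \<times> 'a \<Rightarrow> real"
  defines "N \<equiv> circle \<times>\<^sub>M circle \<times>\<^sub>M M"
    and "h \<equiv> pp_metric gR H"
    and "g \<equiv> dual_metric (pp_metric gR H) (T_field H)"
    and "J \<equiv> pp_J gR JR H"
  assumes "closed_manifold M"
    and "almost_kaehler M gR JR"
    and "smooth_function (circle \<times>\<^sub>M M) H"
  shows "almost_kaehler N g J
    \<and> \<not> proper_warped_product3 circle circle M g
    \<and> (\<not> constant_on_M M H \<longrightarrow> \<not> warped_product3 circle circle M g)
    \<and> (kaehler N g J \<longleftrightarrow> constant_on_M M H \<and> kaehler M gR JR)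
    \<and> coclosed N h 2 (fundamental_form g J)"
proof -
  interpret almost_kaehler_pp M gR JR H
    using assms(5-7) by unfold_locales (simp_all add: closed_manifold_def)
  show ?thesis
    unfolding N_def h_def g_def J_def
    using almost_kaehler_N not_proper_warped warped_imp_constant_on_M integrable_N_iff almost_kaehler_M coclosed_N
    by (auto simp: kaehler_def)
qed

end
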